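(* Let $X$ be a separable Banach space such that $X^*$ has the weak$^*$ summable tree property. Then $X$ is isomorphic to a subspace of $c_0$.
   Context: Trees: let $\mathcal F\mathbb N$ be the set of all finite subsets of $\mathbb N$, partially ordered by: $a\le b$ iff, writing $a=\{n_1<\dots<n_k\}$ and $b=\{m_1<\dots<m_l\}$, we have $k\le l$ and $m_i=n_i$ for $1\le i\le k$ (i.e. $a$ is an initial segment of $b$). $b$ is a successor of $a$ if $a\le b$ and $|b|=|a|+1$; $a+$ denotes the collection of successors of $a$ (for an assignment on $S$, the successors in $S$); for $a\neq\emptyset$, $a-$ is the unique predecessor of $a$. A full tree is a set $S\subset\mathcal F\mathbb N$ such that (1) $\emptyset\in S$; (2) each $a\in S$ has infinitely many successors in $S$; (3) if $\emptyset\ne a\in S$ then $a-\in S$. A full subtree of $S$ is a full tree $T\subset S$. A branch of $S$ is a sequence $\beta=\{a_n\}_{n=0}^\infty$ in $S$ with $a_0=\emptyset$ and $a_{n+1}$ a successor of $a_n$ for all $n\ge0$. A tree-map in a vector space $V$ is a map $a\mapsto x_a\in V$ defined on a full tree $S$ with $x_\emptyset=0$ and such that for every branch $\beta$ of $S$ the set $\{a\in\beta: x_a\ne0\}$ is finite. A tree-map $(x_a^* )_{a\in S}$ in $X^*$ is weak$^*$-null if for every $a\in S$ the family $\{x_b^*\}_{b\in a+}$ is a weak$^*$-null sequence. $X^*$ has the weak$^*$ summable tree property with constant $c>0$ if for every weak$^*$-null tree-map $(x_a^* )_{a\in S}$ in $X^*$ with $\sup_{a\in S}\big\|\sum_{b\le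 a}x_b^*\big\|<\infty$ and every $\epsilon>0$ there is a full subtree $T$ of $S$ such that $\big\|\sum_{a\in\beta}x_a^*\big\|>c\sum_{a\in\beta}\|x_a^*\|-\epsilon$ for every branch $\beta$ of $T$. It has the weak$^*$ summable tree property if this holds for some constant $c>0$. Subspaces are closed; isomorphic means linearly homeomorphic. *)

theory Defs
  imports "HOL-Analysis.Analysis"
begin

text \<open>The initial segment order on finite subsets of \<open>\<nat>\<close>, which are identified with their increasing
  enumerations. The finiteness guard matters: \<^const>\<open>sorted_list_of_set\<close> is empty on infinite sets.\<close>

definition tree_le :: "nat set \<Rightarrow> nat set \<Rightarrow> bool" where
  "tree_le a b \<longleftrightarrow> a \<in> Fpow UNIV \<and> b \<in> Fpow UNIV \<and> card a \<le> card b \<and>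
     (\<forall>i < card a. sorted_list_of_set b ! i = sorted_list_of_set a ! i)"

definition tree_succ :: "nat set \<Rightarrow> nat set \<Rightarrow> bool" where
  "tree_succ a b \<longleftrightarrow> tree_le a b \<and> card b = card a + 1"

definition successors :: "nat set set \<Rightarrow> nat set \<Rightarrow> nat set set" where
  "successors S a = {b \<in> S. tree_succ a b}"

text \<open>Only meaningful for nonempty finite \<open>b\<close>.\<close>

definition tree_pred :: "nat set \<Rightarrow> nat set" where
  "tree_pred b = (THE a. tree_succ a b)"

definition full_tree :: "nat set set \<Rightarrow> bool" where
  "full_tree S \<longleftrightarrow> S \<subseteq> Fpow UNIV \<and> {} \<in> S \<and> (\<forall>a\<in>S. infinite (successors S a)) \<and>
     (\<forall>a\<in>S. a \<noteq> {} \<longrightarrow> tree_pred a \<in> S)"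

definition is_branch :: "nat set set \<Rightarrow> (nat \<Rightarrow> nat set) \<Rightarrow> bool" where
  "is_branch S \<beta> \<longleftrightarrow> range \<beta> \<subseteq> S \<and> \<beta> 0 = {} \<and> (\<forall>n. tree_succ (\<beta> n) (\<beta> (Suc n)))"

text \<open>Tree-maps are total functions of which only the values on \<open>S\<close> are relevant.\<close>

definition tree_map :: "nat set set \<Rightarrow> (nat set \<Rightarrow> 'v::real_vector) \<Rightarrow> bool" where
  "tree_map S x \<longleftrightarrow> full_tree S \<and> x {} = 0 \<and>
     (\<forall>\<beta>. is_branch S \<beta> \<longrightarrow> finite {a \<in> range \<beta>. x a \<noteq> 0})"

text \<open>For scalar-valued operators the strong operator topology, i.e. the topology of pointwise
  convergence on \<open>X\<close>, is the weak\<open>*\<close> topology of the dual \<open>X \<Rightarrow>\<^sub>L real\<close>.\<close>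

definition weak_star_topology :: "('a::real_normed_vector \<Rightarrow>\<^sub>L real) topology" where
  "weak_star_topology = strong_operator_topology"

text \<open>Convergence along the countable family indexed by the successors of \<open>a\<close> does not depend on the
  enumeration chosen; it is expressed here by the filter of cofinite subsets of the index set.\<close>

definition weak_star_null :: "nat set set \<Rightarrow> (nat set \<Rightarrow> ('a::real_normed_vector \<Rightarrow>\<^sub>L real)) \<Rightarrow> bool" where
  "weak_star_null S x \<longleftrightarrow>
     (\<forall>a\<in>S. limitin weak_star_topology x 0 (inf cofinite (principal (successors S a))))"

text \<open>\<^const>\<open>sum'\<close> sums over the support when that is finite, which is the case on every branch by
  definition of a tree-map; the index set \<open>range \<beta>\<close> itself is infinite.\<close>

definition weak_star_summable_tree_property_with ::
    "'a::real_normed_vector itself \<Rightarrow> real \<Rightarrow> bool" where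
  "weak_star_summable_tree_property_with _ c \<longleftrightarrow>
     (\<forall>S (x :: nat set \<Rightarrow> ('a \<Rightarrow>\<^sub>L real)).
        tree_map S x \<longrightarrow> weak_star_null S x \<longrightarrow>
        bdd_above ((\<lambda>a. norm (\<Sum>b | b \<in> S \<and> tree_le b a. x b)) ` S) \<longrightarrow>
        (\<forall>\<epsilon>>0. \<exists>T. full_tree T \<and> T \<subseteq> S \<and>
           (\<forall>\<beta>. is_branch T \<beta> \<longrightarrow>
              norm (sum' x (range \<beta>)) > c * sum' (\<lambda>a. norm (x a)) (range \<beta>) - \<epsilon>)))"

text \<open>The argument \<open>TYPE('a)\<close> stands for the space \<open>X\<close>; the property is that of its dual.\<close>

definition weak_star_summable_tree_property :: "'a::real_normed_vector itself \<Rightarrow> bool" where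
  "weak_star_summable_tree_property X \<longleftrightarrow>
     (\<exists>c>0. weak_star_summable_tree_property_with X c)"

text \<open>The type \<open>nat \<Rightarrow>\<^sub>C real\<close> is \<open>\<ell>\<^sub>\<infinity>\<close> with the supremum norm, as \<open>nat\<close> carries the discrete topology.\<close>

definition c0 :: "(nat \<Rightarrow>\<^sub>C real) set" where
  "c0 = {f. apply_bcontfun f \<longlonglongrightarrow> 0}"

text \<open>\<open>Z\<close> is meant to be closed, so that closedness of \<open>Y\<close> in \<open>Z\<close> and in the whole type agree.\<close>

definition isomorphic_to_subspace_of ::
    "'a::real_normed_vector itself \<Rightarrow> 'b::real_normed_vector set \<Rightarrow> bool" where
  "isomorphic_to_subspace_of _ Z \<longleftrightarrow>
     (\<exists>Y (f :: 'a \<Rightarrow> 'b) g. subspace Y \<and> closed Y \<and> Y \<subseteq> Z \<and> linear f \<and> homeomorphism UNIV Y f g)"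

end

theory Submission
  imports Defs "HOL-Complex_Analysis.Great_Picard"
begin

text \<open>For a functional \<open>x\<close> in a fixed ball let \<open>N x\<close> be the infimum, over bounded weak\<open>*\<close>-null trees, of the
  supremum over all branches of \<open>\<parallel>x + \<Sum>x\<^sub>a\<parallel> - c \<Sum>\<parallel>x\<^sub>a\<parallel>\<close>. The tree property says that \<open>N\<close> is bounded below.
  Grafting the trees of the \<open>z\<^sub>n\<close> onto a first step \<open>z\<^sub>n - x\<close> shows that \<open>N z\<^sub>n\<close> is asymptotically at
  least \<open>N x + c \<parallel>z\<^sub>n - x\<parallel>\<close> whenever \<open>z\<^sub>n\<close> tends weak\<open>*\<close> to \<open>x\<close>.

  Let a functional \<open>x\<close> of the unit ball be revealed through its values on longer and longer initial
  segments of a dense sequence. At each stage it is approximated by a member of a finite set of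
  guesses, chosen so that everything agreeing with a guess \<open>y\<close> at the next stage has \<open>N\<close>-value at least
  about \<open>N y + c \<parallel>z - y\<parallel>\<close>. By weak\<open>*\<close> compactness there are infinitely many stages, spread uniformly in
  \<open>x\<close>, where two consecutive guesses nearly coincide. Along these stages every change of the guess is
  paid for by an increase of the bounded quantity \<open>N\<close>, so the changes are summable with a uniform bound.
  The guesses converge weak\<open>*\<close> to \<open>x\<close>, and the normalised changes range over finite sets tending weak\<open>*\<close> to
  zero; hence these finite sets define an embedding into \<open>c\<^sub>0\<close>.\<close>

subsection \<open>Norming functionals\<close>

definition sublinear :: "('a::real_vector \<Rightarrow> real) \<Rightarrow> bool" where
  "sublinear p \<longleftrightarrow> (\<forall>x y. p (x + y) \<le> p x + p y) \<and> (\<forall>r\<ge>0. \<forall>x. p (r *\<^sub>R x) \<le> r * p x)"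

lemma sublinearD:
  assumes "sublinear p"
  shows "p (x + y) \<le> p x + p y" "0 \<le> r \<Longrightarrow> p (r *\<^sub>R x) \<le> r * p x"
  using assms by (auto simp: sublinear_def)

lemma sublinear_zero: "sublinear p \<Longrightarrow> p 0 = 0"
  using sublinearD[of p 0 0] sublinearD(2)[of p 0 0] by auto

lemma sublinear_scaleR:
  assumes "sublinear p" "0 \<le> r"
  shows "p (r *\<^sub>R x) = r * p x"
proof (cases "r = 0")
  case False
  have "p (inverse r *\<^sub>R r *\<^sub>R x) \<le> inverse r * p (r *\<^sub>R x)"
    using assms by (intro sublinearD) auto
  then have "r * p x \<le> p (r *\<^sub>R x)"
    using False assms by (simp add: field_simps)
  then show ?thesis using sublinearD(2)[OF assms, of x] by simp
qed (use sublinear_zero[OF assms(1)] in simp)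

lemma sublinear_norm: "sublinear (norm :: 'a::real_normed_vector \<Rightarrow> real)"
  by (auto simp: sublinear_def norm_triangle_ineq)

text \<open>For a minimal \<open>p\<close> the tilt in direction \<open>y\<close> must coincide with \<open>p\<close>, which makes \<open>p\<close> additive; this
  replaces the extension from subspaces in the Hahn-Banach theorem.\<close>

lemma sublinear_tilt:
  fixes p :: "'a::real_vector \<Rightarrow> real"
  assumes p: "sublinear p"
  defines "q \<equiv> \<lambda>y x. INF t\<in>{0..}. p (x + t *\<^sub>R y) - t * p y"
  shows "sublinear (q y)" "q y x \<le> p x" "q y x \<le> p (x + y) - p y"
proof -
  have lb: "- p (- x) \<le> p (x + t *\<^sub>R y) - t * p y" if "t \<ge> 0" for x t
    using sublinearD(1)[OF p, of "x + t *\<^sub>R y" "- x"] sublinear_scaleR[OF p that, of y] by simp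
  have bdd: "bdd_below ((\<lambda>t. p (x + t *\<^sub>R y) - t * p y) ` {0..})" for x
    using lb[of _ x] by (auto intro!: bdd_belowI2)
  have le: "q y x \<le> p (x + t *\<^sub>R y) - t * p y" if "t \<ge> 0" for x t
    unfolding q_def using that by (intro cINF_lower bdd) auto
  have ex: "\<exists>t\<ge>0. p (x + t *\<^sub>R y) - t * p y < q y x + e" if "e > 0" for x e
    using cINF_less_iff[OF _ bdd, of x "q y x + e"] that by (auto simp: q_def)
  show "q y x \<le> p x" using le[of 0 x] by simp
  show "q y x \<le> p (x + y) - p y" using le[of 1 x] by simp
  have add: "q y (x + z) \<le> q y x + q y z" for x z
  proof (rule field_le_epsilon)
    fix e :: real assume "e > 0"
    then obtain s t where s: "s \<ge> 0" "p (x + s *\<^sub>R y) - s * p y < q y x + e / 2"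
      and t: "t \<ge> 0" "p (z + t *\<^sub>R y) - t * p y < q y z + e / 2"
      using ex[of "e / 2" x] ex[of "e / 2" z] by auto
    have "q y (x + z) \<le> p ((x + s *\<^sub>R y) + (z + t *\<^sub>R y)) - (s + t) * p y"
      using le[of "s + t" "x + z"] s t by (simp add: algebra_simps)
    also have "\<dots> \<le> p (x + s *\<^sub>R y) + p (z + t *\<^sub>R y) - (s + t) * p y"
      using sublinearD(1)[OF p] by simp
    finally show "q y (x + z) \<le> q y x + q y z + e" using s t by (simp add: algebra_simps)
  qed
  have "q y (r *\<^sub>R x) \<le> r * q y x" if r: "r \<ge> 0" for r x
  proof (cases "r = 0")
    case True
    then show ?thesis using le[of 0 0] sublinear_zero[OF p] by simp
  next
    case False
    have "q y (r *\<^sub>R x) / r \<le> q y x"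
    proof (rule field_le_epsilon)
      fix e :: real assume "e > 0"
      then obtain t where t: "t \<ge> 0" "p (x + t *\<^sub>R y) - t * p y < q y x + e" using ex by blast
      have "q y (r *\<^sub>R x) \<le> p (r *\<^sub>R (x + t *\<^sub>R y)) - r * t * p y"
        using le[of "r * t" "r *\<^sub>R x"] r t by (simp add: algebra_simps)
      also have "\<dots> = r * (p (x + t *\<^sub>R y) - t * p y)"
        by (simp only: sublinear_scaleR[OF p r] right_diff_distrib mult.assoc)
      also have "\<dots> \<le> r * (q y x + e)" using t r by (intro mult_left_mono) auto
      finally show "q y (r *\<^sub>R x) / r \<le> q y x + e" using False r by (simp add: field_simps)
    qed
    then show ?thesis using False r by (simp add: field_simps)
  qed
  with add show "sublinear (q y)" by (auto simp: sublinear_def)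
qed

lemma minimal_sublinear_linear:
  assumes p: "sublinear p" and min: "\<And>q. sublinear q \<Longrightarrow> q \<le> p \<Longrightarrow> q = p"
  shows "linear p"
proof -
  have "p x \<le> p (x + y) - p y" for x y
  proof -
    have "(\<lambda>x. INF t\<in>{0..}. p (x + t *\<^sub>R y) - t * p y) = p"
      by (rule min) (use sublinear_tilt[OF p] in \<open>simp_all add: le_fun_def\<close>)
    from fun_cong[OF this, of x] show ?thesis
      using sublinear_tilt(3)[OF p, of x y] by simp
  qed
  then have add: "p (x + y) = p x + p y" for x y
    using sublinearD(1)[OF p, of x y] by (simp add: antisym algebra_simps)
  have neg: "p (- x) = - p x" for x
    using add[of x "- x"] sublinear_zero[OF p] by simp
  have "p (r *\<^sub>R x) = r * p x" for r x
    using sublinear_scaleR[OF p, of r x] sublinear_scaleR[OF p, of "- r" x] neg[of "r *\<^sub>R x"]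
    by (cases "r \<ge> 0") auto
  with add show ?thesis by (intro linearI) auto
qed

text \<open>Zorn's lemma for the reversed pointwise order gives a minimal sublinear minorant, which
  is linear. A nonempty chain is bounded by its pointwise infimum, finite because 0 \<le> q x + q (-
  x) and q \<le> p.\<close>

lemma ex_linear_below_sublinear:
  fixes p :: "'a::real_vector \<Rightarrow> real"
  assumes p: "sublinear p"
  shows "\<exists>f. linear f \<and> f \<le> p"
proof -
  define A where "A = {q. sublinear q \<and> q \<le> p}"
  have "\<exists>m\<in>A. \<forall>q\<in>A. q \<le> m \<longrightarrow> q = m"
  proof (rule predicate_Zorn)
    show "partial_order_on A (relation_of (\<lambda>q r. r \<le> q) A)"
      by (rule partial_order_on_relation_ofI) simp_all
    fix C assume C: "C \<in> Chains (relation_of (\<lambda>q r. r \<le> q) A)"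
    then have CA: "C \<subseteq> A" and tot: "\<And>q r. q \<in> C \<Longrightarrow> r \<in> C \<Longrightarrow> q \<le> r \<or> r \<le> q"
      by (auto simp: Chains_def relation_of_def)
    show "\<exists>u\<in>A. \<forall>q\<in>C. u \<le> q"
    proof (cases "C = {}")
      case True
      then show ?thesis using p by (auto simp: A_def)
    next
      case False
      define u where "u x = (INF q\<in>C. q x)" for x
      have bdd: "bdd_below ((\<lambda>q. q x) ` C)" for x
      proof (rule bdd_belowI2)
        fix q assume "q \<in> C"
        then have q: "sublinear q" "q \<le> p" using CA by (auto simp: A_def)
        show "- p (- x) \<le> q x"
          using sublinearD(1)[OF q(1), of x "- x"] sublinear_zero[OF q(1)] le_funD[OF q(2), of "- x"]
          by simp
      qed
      have le: "u x \<le> q x" if "q \<in> C" for q x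
        unfolding u_def using that by (intro cINF_lower bdd)
      have ex: "\<exists>q\<in>C. q x < u x + e" if "e > 0" for x e
        using cINF_less_iff[OF False bdd, of x "u x + e"] that by (auto simp: u_def)
      have "u (x + y) \<le> u x + u y" for x y
      proof (rule field_le_epsilon)
        fix e :: real assume "e > 0"
        then obtain q r where q: "q \<in> C" "q x < u x + e / 2" and r: "r \<in> C" "r y < u y + e / 2"
          using ex[of "e / 2" x] ex[of "e / 2" y] by auto
        have "\<exists>s\<in>C. s \<le> q \<and> s \<le> r" using tot[OF q(1) r(1)] q r by auto
        then obtain s where s: "s \<in> C" "s \<le> q" "s \<le> r" by blast
        have "u (x + y) \<le> s x + s y"
        proof -
          have "sublinear s" using s(1) CA by (auto simp: A_def)
          then show ?thesis using le[OF s(1), of "x + y"] sublinearD(1)[of s x y] by simp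
        qed
        then show "u (x + y) \<le> u x + u y + e"
          using q r le_funD[OF s(2), of x] le_funD[OF s(3), of y] by simp
      qed
      moreover have "u (r *\<^sub>R x) \<le> r * u x" if "r \<ge> 0" for r x
      proof (cases "r = 0")
        case True
        obtain q where "q \<in> C" using False by blast
        moreover from this have "q 0 = 0" using CA sublinear_zero by (auto simp: A_def)
        ultimately show ?thesis using le[of q 0] True by simp
      next
        case r: False
        have "u (r *\<^sub>R x) / r \<le> u x"
        proof (rule field_le_epsilon)
          fix e :: real assume "e > 0"
          then obtain q where q: "q \<in> C" "q x < u x + e" using ex by blast
          have "u (r *\<^sub>R x) \<le> q (r *\<^sub>R x)" using le q by blast
          also have "\<dots> \<le> r * q x" using q CA that by (intro sublinearD) (auto simp: A_def)
          also have "\<dots> \<le> r * (u x + e)" using q that by (intro mult_left_mono) auto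
          finally show "u (r *\<^sub>R x) / r \<le> u x + e" using r that by (simp add: field_simps)
        qed
        then show ?thesis using r that by (simp add: field_simps)
      qed
      ultimately have "sublinear u" by (auto simp: sublinear_def)
      moreover have "u \<le> p"
      proof -
        obtain q where "q \<in> C" using False by blast
        then have "u \<le> q" "q \<le> p" using le CA by (auto simp: A_def le_fun_def)
        then show ?thesis by simp
      qed
      ultimately show ?thesis using le by (intro bexI[of _ u]) (simp_all add: A_def le_fun_def)
    qed
  qed
  then obtain m where m: "sublinear m" "m \<le> p" "\<And>q. q \<in> A \<Longrightarrow> q \<le> m \<Longrightarrow> q = m"
    by (auto simp: A_def)
  have "linear m"
  proof (rule minimal_sublinear_linear[OF m(1)])
    fix q assume q: "sublinear q" "q \<le> m"
    have "q \<le> p" using q(2) m(2) by (rule order_trans)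
    with q show "q = m" by (intro m(3)) (simp_all add: A_def)
  qed
  with m show ?thesis by blast
qed

text \<open>Tilting the norm in direction \<open>x\<close> gives \<open>q (- x)\<close> at most
  \<open>- norm x\<close> (take t = 1), so a linear \<open>f\<close> below \<open>q\<close> has
  \<open>f x\<close> at least \<open>norm x\<close>.\<close>

lemma ex_norming_functional:
  fixes x :: "'a::real_normed_vector"
  shows "\<exists>f :: 'a \<Rightarrow>\<^sub>L real. norm f \<le> 1 \<and> blinfun_apply f x = norm x"
proof -
  define q where "q = (\<lambda>z::'a. INF t\<in>{0..}. norm (z + t *\<^sub>R x) - t * norm x)"
  have q: "sublinear q" "\<And>z. q z \<le> norm z" "q (- x) \<le> - norm x"
    using sublinear_tilt[OF sublinear_norm, where y=x] sublinear_tilt(3)[OF sublinear_norm, where y=x and x="-x"]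
    unfolding q_def by auto
  then obtain f where f: "linear f" "f \<le> q" using ex_linear_below_sublinear by blast
  have le: "f z \<le> norm z" for z using le_funD[OF f(2), of z] q(2)[of z] by simp
  have abs_le: "\<bar>f z\<bar> \<le> norm z" for z
    using le[of z] le[of "- z"] linear_neg[OF f(1), of z] by simp
  then have bl: "bounded_linear f"
    using f(1) abs_le by (intro bounded_linear_intro[where K=1]) (simp_all add: linear_add[OF f(1)] linear_scale[OF f(1)])
  have "f x = norm x"
    using le[of x] le_funD[OF f(2), of "- x"] q(3) linear_neg[OF f(1), of x] by simp
  moreover have "norm (Blinfun f) \<le> 1"
    by (rule norm_blinfun_bound) (use abs_le bl in \<open>simp_all add: bounded_linear_Blinfun_apply\<close>)
  ultimately show ?thesis
    using bl by (metis bounded_linear_Blinfun_apply)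
qed

subsection \<open>Weak-star null sequences and embeddings into \<open>c\<^sub>0\<close>\<close>

lemma blinfun_tendsto_dense:
  fixes f :: "nat \<Rightarrow> ('a::real_normed_vector \<Rightarrow>\<^sub>L real)"
  assumes D: "closure D = UNIV" and bd: "\<And>n. norm (f n) \<le> r" 
    and lim: "\<And>u. u \<in> D \<Longrightarrow> (\<lambda>n. f n u) \<longlonglongrightarrow> blinfun_apply l u"
  shows "(\<lambda>n. f n x) \<longlonglongrightarrow> l x"
proof (rule LIMSEQ_I)
  fix e :: real assume e: "e > 0"
  define b where "b = \<bar>r\<bar> + norm l + 1"
  have b: "b > 0" by (simp add: b_def add_nonneg_pos)
  obtain u where u: "u \<in> D" "dist u x < e / 2 / b"
    using D e b closure_approachable[of x D] by (metis UNIV_I divide_pos_pos half_gt_zero)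
  obtain N where N: "\<And>n. n \<ge> N \<Longrightarrow> \<bar>f n u - l u\<bar> < e / 2"
    using LIMSEQ_D[OF lim[OF u(1)], of "e / 2"] e by auto
  have "\<bar>f n x - l x\<bar> < e" if "n \<ge> N" for n
  proof -
    have "\<bar>f n x - l x - (f n u - l u)\<bar> = \<bar>(f n - l) (x - u)\<bar>"
      by (simp add: blinfun.diff_left blinfun.diff_right)
    also have "\<dots> \<le> norm (f n - l) * norm (x - u)"
      using norm_blinfun[of "f n - l" "x - u"] by simp
    also have "\<dots> \<le> b * norm (x - u)"
      using norm_triangle_ineq4[of "f n" l] bd[of n] by (intro mult_right_mono) (auto simp: b_def)
    also have "\<dots> < e / 2"
      using u(2) b by (simp add: dist_norm norm_minus_commute field_simps)
    finally show ?thesis using N[OF that] by linarith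
  qed
  then show "\<exists>N. \<forall>n\<ge>N. norm (f n x - l x) < e" by auto
qed

text \<open>Sequential Banach-Alaoglu theorem: a diagonal subsequence converges on \<open>D\<close>,
  and the uniform norm bound spreads the Cauchy property to all points.\<close>

lemma weak_star_convergent_subsequence:
  fixes f :: "nat \<Rightarrow> ('a::real_normed_vector \<Rightarrow>\<^sub>L real)" and D :: "'a set"
  assumes D: "countable D" "closure D = UNIV" and bd: "\<And>n. norm (f n) \<le> r"
  shows "\<exists>k l. strict_mono (k :: nat \<Rightarrow> nat) \<and> norm l \<le> r \<and> (\<forall>x. (\<lambda>n. f (k n) x) \<longlonglongrightarrow> blinfun_apply l x)"
proof -
  have r: "r \<ge> 0" using bd[of 0] norm_ge_zero[of "f 0"] by linarith
  have bd': "\<bar>f n x\<bar> \<le> r * norm x" for n x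
    using norm_blinfun[of "f n" x] mult_right_mono[OF bd[of n] norm_ge_zero[of x]] by simp
  obtain k :: "nat \<Rightarrow> nat" where k: "strict_mono k" "\<And>x. x \<in> D \<Longrightarrow> \<exists>l. (\<lambda>n. f (k n) x) \<longlonglongrightarrow> l"
  proof -
    \<comment> \<open>The diagonal argument is applied with one bound for all points, hence the
      weight 1 + norm x, removed again below.\<close>
    have "norm (f n x / (1 + norm x)) \<le> r" for n x
    proof -
      have "\<bar>f n x\<bar> \<le> r * (1 + norm x)" using bd'[of n x] r by (simp add: distrib_left)
      then show ?thesis by (simp add: divide_le_eq add_pos_nonneg)
    qed
    then obtain k :: "nat \<Rightarrow> nat" where k: "strict_mono k"
      "\<And>x. x \<in> D \<Longrightarrow> \<exists>l. (\<lambda>n. f (k n) x / (1 + norm x)) \<longlonglongrightarrow> l"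
      by (rule function_convergent_subsequence[OF D(1), of "\<lambda>n x. f n x / (1 + norm x)" r]) auto
    have "\<exists>l. (\<lambda>n. f (k n) x) \<longlonglongrightarrow> l" if x: "x \<in> D" for x
    proof -
      obtain l where "(\<lambda>n. f (k n) x / (1 + norm x)) \<longlonglongrightarrow> l" using k(2)[OF x] by blast
      from tendsto_mult_right[OF this, of "1 + norm x"]
      have "(\<lambda>n. f (k n) x) \<longlonglongrightarrow> l * (1 + norm x)"
        using norm_ge_zero[of x] by (simp add: add_nonneg_eq_0_iff)
      then show ?thesis by blast
    qed
    with k(1) show ?thesis by (rule that)
  qed
  have "convergent (\<lambda>n. f (k n) x)" for x
  proof (rule Cauchy_convergent, rule CauchyI)
    fix e :: real assume e: "e > 0"
    have "e / 4 / (r + 1) > 0" using e r by simp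
    then obtain u where u: "u \<in> D" "dist u x < e / 4 / (r + 1)"
      using D(2) closure_approachable[of x D] by (metis UNIV_I)
    have close: "\<bar>f n x - f n u\<bar> < e / 4" for n
    proof -
      have "\<bar>f n x - f n u\<bar> \<le> r * norm (x - u)"
        using bd'[of n "x - u"] by (simp add: blinfun.diff_right)
      also have "\<dots> \<le> (r + 1) * norm (x - u)" by (simp add: distrib_right)
      also have "\<dots> < e / 4" using u(2) r by (simp add: dist_norm norm_minus_commute field_simps)
      finally show ?thesis .
    qed
    have "Cauchy (\<lambda>n. f (k n) u)" using k(2)[OF u(1)] by (auto intro: LIMSEQ_imp_Cauchy)
    then obtain M where M: "\<And>m n. m \<ge> M \<Longrightarrow> n \<ge> M \<Longrightarrow> \<bar>f (k m) u - f (k n) u\<bar> < e / 4"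
      using CauchyD[of "\<lambda>n. f (k n) u" "e / 4"] e by auto
    have "\<bar>f (k m) x - f (k n) x\<bar> < e" if "m \<ge> M" "n \<ge> M" for m n
      using M[OF that] close[of "k m"] close[of "k n"] e by (simp only: abs_less_iff) linarith
    then show "\<exists>M. \<forall>m\<ge>M. \<forall>n\<ge>M. norm (f (k m) x - f (k n) x) < e" by auto
  qed
  then obtain g where g: "\<And>x. (\<lambda>n. f (k n) x) \<longlonglongrightarrow> g x"
    unfolding convergent_def by metis
  have gle: "\<bar>g x\<bar> \<le> r * norm x" for x
    using bd' by (intro Lim_bounded[OF tendsto_rabs[OF g[of x]], of 0]) auto
  have "g (x + y) = g x + g y" for x y
    using g[of "x + y"] tendsto_add[OF g[of x] g[of y]]
    by (intro LIMSEQ_unique[of "\<lambda>n. f (k n) (x + y)"]) (auto simp: blinfun.add_right)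
  moreover have "g (a *\<^sub>R x) = a * g x" for a x
    using g[of "a *\<^sub>R x"] tendsto_mult_left[OF g[of x], of a]
    by (intro LIMSEQ_unique[of "\<lambda>n. f (k n) (a *\<^sub>R x)"]) (auto simp: blinfun.scaleR_right)
  ultimately have bl: "bounded_linear g"
    using gle by (intro bounded_linear_intro[where K=r]) (auto simp: mult.commute)
  have "norm (Blinfun g) \<le> r"
    using gle r bl by (intro norm_blinfun_bound) (auto simp: bounded_linear_Blinfun_apply)
  then show ?thesis using k(1) g bl
    by (intro exI[of _ k] exI[of _ "Blinfun g"]) (auto simp: bounded_linear_Blinfun_apply)
qed

text \<open>The embedding sends x to the sequence of the \<open>f n x\<close>. The norming
  hypothesis bounds it from below, which makes the inverse Lipschitz and, as the domain is complete,
  the range closed.\<close>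

lemma isomorphic_to_subspace_of_c0:
  fixes f :: "nat \<Rightarrow> ('a::banach \<Rightarrow>\<^sub>L real)"
  assumes bd: "\<And>n. norm (f n) \<le> 1" and null: "\<And>x. (\<lambda>n. f n x) \<longlonglongrightarrow> 0"
    and d: "d > 0" and norming: "\<And>x. \<exists>n. d * norm x \<le> \<bar>f n x\<bar>"
  shows "isomorphic_to_subspace_of TYPE('a) c0"
proof -
  have bd': "\<bar>f n x\<bar> \<le> norm x" for n x
    using norm_blinfun[of "f n" x] mult_right_mono[OF bd[of n] norm_ge_zero[of x]] by simp
  define T where "T x = Bcontfun (\<lambda>n. f n x)" for x
  have T: "apply_bcontfun (T x) n = f n x" for x n
    unfolding T_def using bd' by (subst Bcontfun_inverse) (auto intro!: bcontfun_normI)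
  have lin: "linear T"
    by (intro linearI bcontfun_eqI) (auto simp: T blinfun.add_right blinfun.scaleR_right)
  have up: "norm (T x) \<le> norm x" for x
    using bd' by (intro norm_bound) (auto simp: T)
  have low: "d * norm x \<le> norm (T x)" for x
  proof -
    obtain n where "d * norm x \<le> \<bar>f n x\<bar>" using norming by blast
    then show ?thesis using norm_bounded[of "T x" n] by (simp add: T)
  qed
  have bl: "bounded_linear T"
    using up lin by (intro bounded_linear_intro[where K=1]) (auto simp: linear_add[OF lin] linear_scale[OF lin])
  have inj: "inj T"
  proof (rule injI)
    fix u v assume "T u = T v"
    then have "d * norm (u - v) \<le> 0" using low[of "u - v"] by (simp add: linear_diff[OF lin])
    then show "u = v" using d by (simp add: mult_le_0_iff)
  qed
  define g where "g = inv T"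
  have gT: "g (T x) = x" for x using inj by (simp add: g_def)
  have "homeomorphism UNIV (range T) T g"
  proof (rule homeomorphismI)
    show "continuous_on UNIV T" using bl by (rule linear_continuous_on)
    have "dist (g y) (g z) \<le> 1 / d * dist y z" if "y \<in> range T" "z \<in> range T" for y z
    proof -
      from that obtain u v where uv: "y = T u" "z = T v" by auto
      have "d * norm (u - v) \<le> norm (T u - T v)"
        using low[of "u - v"] by (simp add: linear_diff[OF lin])
      then show ?thesis using d by (simp add: uv gT dist_norm field_simps)
    qed
    then have "(1 / d)-lipschitz_on (range T) g"
      using d by (intro lipschitz_onI) auto
    then show "continuous_on (range T) g" by (rule lipschitz_on_continuous_on)
  qed (auto simp: gT)
  moreover have "closed (range T)"
    using complete_isometric_image[OF d subspace_UNIV bl] low complete_UNIV complete_imp_closed by auto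
  moreover have "subspace (range T)" using lin subspace_UNIV by (rule linear_subspace_image)
  moreover have "range T \<subseteq> c0" using null by (auto simp: c0_def fun_eq_iff[THEN iffD2, OF allI, OF T])
  ultimately show ?thesis unfolding isomorphic_to_subspace_of_def using lin by blast
qed

text \<open>A pairing function arranges the blocks in one sequence, padded with 0. Only finitely
  many entries other than padding come from blocks below a given \<open>J\<close>, so smallness in
  late blocks becomes convergence to 0 on \<open>D\<close>, and by the norm bound
  everywhere.\<close>

lemma isomorphic_to_subspace_of_c0_blocks:
  fixes G :: "nat \<Rightarrow> ('a::banach \<Rightarrow>\<^sub>L real) set" and D :: "'a set"
  assumes fin: "\<And>j. finite (G j)" and bd: "\<And>j f. f \<in> G j \<Longrightarrow> norm f \<le> 1"
    and D: "closure D = UNIV"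
    and null: "\<And>v e. v \<in> D \<Longrightarrow> 0 < e \<Longrightarrow> \<exists>J. \<forall>j\<ge>J. \<forall>f\<in>G j. \<bar>blinfun_apply f v\<bar> < e"
    and d: "d > 0" and norming: "\<And>v. v \<noteq> 0 \<Longrightarrow> \<exists>j. \<exists>f\<in>G j. d * norm v \<le> \<bar>blinfun_apply f v\<bar>"
  shows "isomorphic_to_subspace_of TYPE('a) c0"
proof -
  have "\<forall>j. \<exists>xs. set xs = G j" using finite_list[OF fin] by blast
  then obtain g where g: "\<And>j. set (g j) = G j" by metis
  define h where "h p = (if snd p < length (g (fst p)) then g (fst p) ! snd p else 0)" for p
  define f where "f n = h (prod_decode n)" for n
  have h: "h (j, i) \<in> insert 0 (G j)" for j i
    using nth_mem[of i "g j"] by (auto simp: h_def g)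
  have bd': "norm (f n) \<le> 1" for n
    using h[of "fst (prod_decode n)" "snd (prod_decode n)"] bd by (auto simp: f_def)
  have dense: "(\<lambda>n. blinfun_apply (f n) v) \<longlonglongrightarrow> 0" if v: "v \<in> D" for v
  proof (rule tendstoI)
    fix e :: real assume e: "e > 0"
    obtain J where J: "\<And>j f. j \<ge> J \<Longrightarrow> f \<in> G j \<Longrightarrow> \<bar>blinfun_apply f v\<bar> < e"
      using null[OF v e] by blast
    have "{n. \<not> dist (blinfun_apply (f n) v) 0 < e}
        \<subseteq> prod_encode ` (SIGMA j:{..<J}. {..<length (g j)})"
    proof
      fix n assume "n \<in> {n. \<not> dist (blinfun_apply (f n) v) 0 < e}"
      then have n: "\<not> \<bar>blinfun_apply (f n) v\<bar> < e" by simp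
      obtain j i where ji: "prod_decode n = (j, i)" by fastforce
      have len: "i < length (g j)" using n e by (auto simp: f_def h_def ji split: if_splits)
      then have "f n \<in> G j" using nth_mem[OF len] by (simp add: f_def h_def ji g)
      then have "j < J" using J[of j "f n"] n by force
      moreover have "n = prod_encode (j, i)" using ji prod_decode_inverse by metis
      ultimately show "n \<in> prod_encode ` (SIGMA j:{..<J}. {..<length (g j)})" using len by blast
    qed
    then have "finite {n. \<not> dist (blinfun_apply (f n) v) 0 < e}" by (rule finite_subset) auto
    then show "eventually (\<lambda>n. dist (blinfun_apply (f n) v) 0 < e) sequentially"
      by (simp only: cofinite_eq_sequentially[symmetric] eventually_cofinite)
  qed
  show ?thesis
  proof (rule isomorphic_to_subspace_of_c0[OF bd' _ d])
    show "(\<lambda>n. blinfun_apply (f n) v) \<longlonglongrightarrow> 0" for v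
      using blinfun_tendsto_dense[OF D bd', where l=0] dense by simp
    fix v :: 'a
    show "\<exists>n. d * norm v \<le> \<bar>blinfun_apply (f n) v\<bar>"
    proof (cases "v = 0")
      case False
      then obtain j l where l: "l \<in> G j" "d * norm v \<le> \<bar>blinfun_apply l v\<bar>"
        using norming by blast
      then obtain i where "i < length (g j)" "g j ! i = l" by (metis g in_set_conv_nth)
      then have "f (prod_encode (j, i)) = l" by (simp add: f_def h_def)
      with l(2) show ?thesis by blast
    qed simp
  qed
qed

subsection \<open>Weak-star null trees\<close>

text \<open>Some weak\<open>*\<close>-null tree with finite branches, starting at \<open>x\<close> and with all partial sums in the ball of
  radius 2, satisfies \<open>\<parallel>x + \<Sum>x\<^sub>a\<parallel> - c \<Sum>\<parallel>x\<^sub>a\<parallel> \<le> r\<close> on every branch.\<close>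

inductive tree_bound :: "real \<Rightarrow> ('a::real_normed_vector \<Rightarrow>\<^sub>L real) \<Rightarrow> real \<Rightarrow> bool" for c where
  leaf: "norm x \<le> 2 \<Longrightarrow> norm x \<le> r \<Longrightarrow> tree_bound c x r"
| node: "norm x \<le> 2 \<Longrightarrow> (\<And>u. (\<lambda>n. blinfun_apply (z n) u) \<longlonglongrightarrow> blinfun_apply x u) \<Longrightarrow>
    (\<And>n. tree_bound c (z n) (r + c * norm (z n - x))) \<Longrightarrow> tree_bound c x r"

lemma tree_bound_norm: "tree_bound c x r \<Longrightarrow> norm x \<le> 2"
  by (auto elim: tree_bound.cases)

lemma tree_bound_mono: "tree_bound c x r \<Longrightarrow> r \<le> s \<Longrightarrow> tree_bound c x s"
proof (induction arbitrary: s rule: tree_bound.induct)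
  case (node x z r)
  show ?case by (rule tree_bound.node[OF node(1,2)]) (use node.prems in \<open>auto intro: node.IH\<close>)
next
  case (leaf x r)
  then show ?case by (intro tree_bound.leaf) simp_all
qed

text \<open>Contracting a tree towards \<open>q\<close> keeps it in the ball; this provides the Lipschitz estimate for the
  value, which a translation of the tree would not.\<close>

lemma tree_bound_convex:
  assumes "tree_bound c x r" "norm q \<le> 2" "0 \<le> s" "s \<le> 1"
  shows "tree_bound c ((1 - s) *\<^sub>R x + s *\<^sub>R q) ((1 - s) * r + s * 2)"
  using assms(1)
proof (induction rule: tree_bound.induct)
  case (leaf x r)
  have le: "norm ((1 - s) *\<^sub>R x + s *\<^sub>R q) \<le> (1 - s) * t + s * 2" if "norm x \<le> t" for t
  proof -
    have "norm ((1 - s) *\<^sub>R x + s *\<^sub>R q) \<le> (1 - s) * norm x + s * norm q"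
      using norm_triangle_ineq[of "(1 - s) *\<^sub>R x" "s *\<^sub>R q"] assms(3,4)
      by (simp only: norm_scaleR abs_of_nonneg diff_ge_0_iff_ge)
    also have "\<dots> \<le> (1 - s) * t + s * 2"
      using that assms(2,3,4) by (intro add_mono mult_left_mono) auto
    finally show ?thesis .
  qed
  show ?case using le[OF leaf(1)] le[OF leaf(2)] by (intro tree_bound.leaf) (simp_all add: algebra_simps)
next
  case (node x z r)
  let ?h = "\<lambda>x. (1 - s) *\<^sub>R x + s *\<^sub>R q"
  show ?case
  proof (rule tree_bound.node[of _ "\<lambda>n. ?h (z n)"])
    have "norm (?h x) \<le> (1 - s) * norm x + s * norm q"
      using norm_triangle_ineq[of "(1 - s) *\<^sub>R x" "s *\<^sub>R q"] assms(3,4)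
      by (simp only: norm_scaleR abs_of_nonneg diff_ge_0_iff_ge)
    also have "\<dots> \<le> (1 - s) * 2 + s * 2"
      using node(1) assms(2,3,4) by (intro add_mono mult_left_mono) auto
    finally show "norm (?h x) \<le> 2" by simp
    show "(\<lambda>n. blinfun_apply (?h (z n)) u) \<longlonglongrightarrow> blinfun_apply (?h x) u" for u
      unfolding blinfun.add_left blinfun.scaleR_left 
      by (rule tendsto_add[OF tendsto_scaleR[OF tendsto_const node(2)] tendsto_const])
    fix n
    have "?h (z n) - ?h x = (1 - s) *\<^sub>R (z n - x)" by (simp add: algebra_simps)
    then have nrm: "norm (?h (z n) - ?h x) = (1 - s) * norm (z n - x)"
      using assms(3,4) by (simp only:) simp
    have eq: "(1 - s) * r + s * 2 + c * norm (?h (z n) - ?h x)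
        = (1 - s) * (r + c * norm (z n - x)) + s * 2" unfolding nrm by (simp add: algebra_simps)
    show "tree_bound c (?h (z n)) ((1 - s) * r + s * 2 + c * norm (?h (z n) - ?h x))"
      unfolding eq by (rule node.IH)
  qed
qed

text \<open>Positions are arbitrary lists of naturals; only strictly increasing ones correspond to nodes of
  the tree of finite sets.\<close>

definition null_list_tree ::
    "real \<Rightarrow> ('a::real_normed_vector \<Rightarrow>\<^sub>L real) \<Rightarrow> real \<Rightarrow> (nat list \<Rightarrow> ('a \<Rightarrow>\<^sub>L real)) \<Rightarrow> bool" where
  "null_list_tree c x r F \<longleftrightarrow> F [] = 0 \<and>
    (\<forall>l u. (\<lambda>n. blinfun_apply (F (l @ [n])) u) \<longlonglongrightarrow> 0) \<and>
    (\<forall>l. norm (x + (\<Sum>k\<le>length l. F (take k l))) \<le> 2) \<and>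
    (\<forall>s. \<exists>M. (\<forall>k\<ge>M. F (map s [0..<k]) = 0) \<and>
       norm (x + (\<Sum>k<M. F (map s [0..<k]))) \<le> r + c * (\<Sum>k<M. norm (F (map s [0..<k]))))"

text \<open>By induction the trees of the \<open>z n\<close> are grafted onto first steps
  \<open>z n - x\<close>, so that partial sums starting at \<open>x\<close> continue as those of
  \<open>G n\<close> starting at \<open>z n\<close>.\<close>

lemma tree_bound_imp_null_list_tree:
  assumes "tree_bound c x r"
  shows "\<exists>F. null_list_tree c x r F"
  using assms
proof (induction rule: tree_bound.induct)
  case (leaf x r)
  then have "null_list_tree c x r (\<lambda>_. 0)" by (simp add: null_list_tree_def)
  then show ?case by blast
next
  case (node x z r)
  then obtain G where G: "\<And>n. null_list_tree c (z n) (r + c * norm (z n - x)) (G n)"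
    by metis
  then have G0: "\<And>n. G n [] = 0"
    and Gnull: "\<And>n l u. (\<lambda>m. blinfun_apply (G n (l @ [m])) u) \<longlonglongrightarrow> 0"
    and Gbd: "\<And>n l. norm (z n + (\<Sum>k\<le>length l. G n (take k l))) \<le> 2"
    and Gbr: "\<And>n s. \<exists>M. (\<forall>k\<ge>M. G n (map s [0..<k]) = 0) \<and>
       norm (z n + (\<Sum>k<M. G n (map s [0..<k]))) \<le>
         r + c * norm (z n - x) + c * (\<Sum>k<M. norm (G n (map s [0..<k])))"
    unfolding null_list_tree_def by blast+
  \<comment> \<open>Each \<open>G n\<close> vanishes at its root, so the position \<open>[n]\<close>
    is free to carry the first increment.\<close>
  define F where "F l = (case l of [] \<Rightarrow> 0 | n # l' \<Rightarrow> if l' = [] then z n - x else G n l')" for l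
  have F0: "F [] = 0" by (simp add: F_def)
  have F1: "F (n # l) = (if l = [] then z n - x else G n l)" for n l by (simp add: F_def)
  have "null_list_tree c x r F"
    unfolding null_list_tree_def
  proof (intro conjI allI F0)
    fix l u
    show "(\<lambda>n. blinfun_apply (F (l @ [n])) u) \<longlonglongrightarrow> 0"
    proof (cases l)
      case Nil
      then show ?thesis using tendsto_diff[OF node(2)[of u] tendsto_const[of "x u"]]
        by (simp add: F1 blinfun.diff_left)
    next
      case (Cons n l')
      then show ?thesis using Gnull[of n l' u] by (simp add: F1)
    qed
  next
    fix l
    show "norm (x + (\<Sum>k\<le>length l. F (take k l))) \<le> 2"
    proof (cases l)
      case Nil
      then show ?thesis using node(1) by (simp add: F0)
    next
      case (Cons n l')
      have "(\<Sum>k\<le>length l. F (take k l)) = (\<Sum>k\<le>length l'. F (n # take k l'))"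
        by (simp add: Cons sum.atMost_Suc_shift F0 del: sum.atMost_Suc)
      also have "\<dots> = (z n - x) + (\<Sum>k=1..length l'. F (n # take k l'))"
        by (simp add: sum.atMost_shift atLeast0AtMost F1 sum.atLeast1_atMost_eq)
      also have "(\<Sum>k=1..length l'. F (n # take k l')) = (\<Sum>k=1..length l'. G n (take k l'))"
        by (intro sum.cong) (auto simp: F1)
      also have "\<dots> = (\<Sum>k\<le>length l'. G n (take k l'))"
        by (simp add: sum.atMost_shift atLeast0AtMost G0 sum.atLeast1_atMost_eq)
      finally show ?thesis using Gbd[of n l'] by (simp add: algebra_simps)
    qed
  next
    fix s :: "nat \<Rightarrow> nat"
    define n where "n = s 0"
    define t where "t = s \<circ> Suc"
    obtain M where M: "\<And>k. k \<ge> M \<Longrightarrow> G n (map t [0..<k]) = 0"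
      "norm (z n + (\<Sum>k<M. G n (map t [0..<k]))) \<le>
         r + c * norm (z n - x) + c * (\<Sum>k<M. norm (G n (map t [0..<k])))"
      using Gbr[of n t] by blast
    have FS: "F (map s [0..<Suc k]) = (if k = 0 then z n - x else G n (map t [0..<k]))" for k
    proof -
      have "map s [0..<Suc k] = n # map t [0..<k]"
        by (simp add: map_upt_Suc n_def t_def del: upt_Suc)
      then show ?thesis by (simp add: F1)
    qed
    \<comment> \<open>Index 0 contributes nothing and index 1 the first increment; the other
      \<open>M\<close> indices run through positions 1 to \<open>M\<close> of \<open>G n\<close>. As
      \<open>G n\<close> vanishes at positions 0 and \<open>M\<close>, this is its sum over
      positions below \<open>M\<close>.\<close>
    have shift: "(\<Sum>k<Suc (Suc M). f k) = f 0 + f 1 + (\<Sum>k<M. f (Suc (Suc k)))" for f :: "nat \<Rightarrow> 'c::ab_group_add"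
      by (simp add: sum.lessThan_Suc_shift del: sum.lessThan_Suc)
    have shift': "(\<Sum>k<M. f (Suc k)) = (\<Sum>k<M. f k) + f M - f 0" for f :: "nat \<Rightarrow> 'c::ab_group_add"
      using sum.lessThan_Suc_shift[of f M] by (simp add: algebra_simps)
    have sum1: "(\<Sum>k<Suc (Suc M). F (map s [0..<k])) = (z n - x) + (\<Sum>k<M. G n (map t [0..<k]))"
      unfolding shift using shift'[of "\<lambda>k. G n (map t [0..<k])"] M(1)[of M]
      by (simp add: FS F0 G0 del: upt_Suc)
    have sum2: "(\<Sum>k<Suc (Suc M). norm (F (map s [0..<k])))
        = norm (z n - x) + (\<Sum>k<M. norm (G n (map t [0..<k])))"
      unfolding shift using shift'[of "\<lambda>k. norm (G n (map t [0..<k]))"] M(1)[of M]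
      by (simp add: FS F0 G0 del: upt_Suc)
    show "\<exists>M. (\<forall>k\<ge>M. F (map s [0..<k]) = 0) \<and>
       norm (x + (\<Sum>k<M. F (map s [0..<k]))) \<le> r + c * (\<Sum>k<M. norm (F (map s [0..<k])))"
    proof (intro exI[of _ "Suc (Suc M)"] conjI allI impI)
      fix k assume "Suc (Suc M) \<le> k"
      then obtain j where "k = Suc j" "j > 0" "M \<le> j" by (cases k) auto
      then show "F (map s [0..<k]) = 0" using M(1)[of j] by (simp add: FS del: upt_Suc)
    next
      show "norm (x + (\<Sum>k<Suc (Suc M). F (map s [0..<k])))
          \<le> r + c * (\<Sum>k<Suc (Suc M). norm (F (map s [0..<k])))"
        unfolding sum1 sum2 using M(2) by (simp add: algebra_simps)
    qed
  qed
  then show ?case by blast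
qed

subsection \<open>Trees of finite sets\<close>

lemma tree_le_imp_take:
  assumes "tree_le a b"
  shows "sorted_list_of_set a = take (card a) (sorted_list_of_set b)"
  using assms by (intro nth_equalityI) (auto simp: tree_le_def)

lemma tree_succ_imp_append:
  assumes "tree_succ a b"
  shows "\<exists>n. sorted_list_of_set b = sorted_list_of_set a @ [n]"
proof -
  have ab: "tree_le a b" "card b = Suc (card a)" using assms by (auto simp: tree_succ_def)
  have "take (Suc (card a)) (sorted_list_of_set b)
      = take (card a) (sorted_list_of_set b) @ [sorted_list_of_set b ! card a]"
    using ab(2) by (intro take_Suc_conv_app_nth) simp
  then have "sorted_list_of_set b = sorted_list_of_set a @ [sorted_list_of_set b ! card a]"
    using ab(2) by (simp add: tree_le_imp_take[OF ab(1)])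
  then show ?thesis by blast
qed

lemma tree_succ_finite: "tree_succ a b \<Longrightarrow> finite a \<and> finite b"
  by (auto simp: tree_succ_def tree_le_def Fpow_def)

lemma tree_succ_unique:
  assumes "tree_succ a c" "tree_succ b c"
  shows "a = b"
proof -
  have "sorted_list_of_set a = sorted_list_of_set b"
    using tree_succ_imp_append[OF assms(1)] tree_succ_imp_append[OF assms(2)] by auto
  then show ?thesis using tree_succ_finite[OF assms(1)] tree_succ_finite[OF assms(2)]
    by (metis sorted_list_of_set.set_sorted_key_list_of_set)
qed

lemma tree_le_set_take:
  assumes "finite a"
  shows "tree_le (set (take k (sorted_list_of_set a))) a"
    and "sorted_list_of_set (set (take k (sorted_list_of_set a))) = take k (sorted_list_of_set a)"
    and "card (set (take k (sorted_list_of_set a))) = min k (card a)"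
proof -
  show *: "sorted_list_of_set (set (take k (sorted_list_of_set a))) = take k (sorted_list_of_set a)"
    by (intro sorted_list_of_set.idem_if_sorted_distinct) (auto simp: sorted_wrt_take strict_sorted_iff)
  show c: "card (set (take k (sorted_list_of_set a))) = min k (card a)"
    using distinct_card[of "take k (sorted_list_of_set a)"] by (simp add: min.commute)
  show "tree_le (set (take k (sorted_list_of_set a))) a"
    using assms * c by (auto simp: tree_le_def Fpow_def)
qed

text \<open>Turns the sums over predecessors in the boundedness hypothesis into sums over prefixes,
  the form in which \<open>null_list_tree\<close> controls them.\<close>

lemma tree_le_predecessors:
  assumes "finite a"
  shows "{b \<in> Fpow UNIV. tree_le b a} = (\<lambda>k. set (take k (sorted_list_of_set a))) ` {..card a}"
proof (intro equalityI subsetI)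
  fix b assume b: "b \<in> {b \<in> Fpow UNIV. tree_le b a}"
  then have "set (sorted_list_of_set b) = b" by (simp add: Fpow_def)
  then have "b = set (take (card b) (sorted_list_of_set a))"
    using b by (simp add: tree_le_imp_take[of b a, symmetric])
  moreover have "card b \<le> card a" using b by (simp add: tree_le_def)
  ultimately show "b \<in> (\<lambda>k. set (take k (sorted_list_of_set a))) ` {..card a}" by blast
next
  fix b assume "b \<in> (\<lambda>k. set (take k (sorted_list_of_set a))) ` {..card a}"
  then show "b \<in> {b \<in> Fpow UNIV. tree_le b a}"
    using tree_le_set_take(1)[OF assms] by (auto simp: Fpow_def)
qed

lemma tree_succ_insert:
  assumes "finite a" "\<And>m. m \<in> a \<Longrightarrow> m < n"
  shows "tree_succ a (insert n a)"
proof -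
  have n: "n \<notin> a" using assms(2) by blast
  have "sorted_list_of_set (insert n a) = sorted_list_of_set a @ [n]"
  proof -
    have "sorted_list_of_set (set (sorted_list_of_set a @ [n])) = sorted_list_of_set a @ [n]"
      using assms n
      by (intro sorted_list_of_set.idem_if_sorted_distinct) (auto simp: sorted_append less_imp_le)
    moreover have "set (sorted_list_of_set a @ [n]) = insert n a" using assms(1) by simp
    ultimately show ?thesis by metis
  qed
  then show ?thesis using assms n
    by (auto simp: tree_succ_def tree_le_def Fpow_def nth_append)
qed

lemma full_tree_Fpow: "full_tree (Fpow UNIV)"
  unfolding full_tree_def
proof (intro conjI ballI impI)
  fix a :: "nat set" assume "a \<in> Fpow UNIV"
  then have a: "finite a" by (simp add: Fpow_def)
  show "infinite (successors (Fpow UNIV) a)"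
  proof
    assume fin: "finite (successors (Fpow UNIV) a)"
    \<comment> \<open>Every large number lies in some successor, but finitely many finite sets
      cannot cover a half-line. Inserting 0 covers the case of empty \<open>a\<close>.\<close>
    have "insert n a \<in> successors (Fpow UNIV) a" if "n > Max (insert 0 a)" for n
      using a that by (auto simp: successors_def Fpow_def intro!: tree_succ_insert)
    then have "{Max (insert 0 a)<..} \<subseteq> \<Union> (successors (Fpow UNIV) a)" by blast
    moreover have "finite (\<Union> (successors (Fpow UNIV) a))"
      using fin by (rule finite_Union) (auto simp: successors_def Fpow_def)
    ultimately show False using infinite_Ioi finite_subset by blast
  qed
  assume "a \<noteq> {}"
  let ?b = "set (take (card a - 1) (sorted_list_of_set a))"
  have "tree_succ ?b a"
    unfolding tree_succ_def using tree_le_set_take[OF a, of "card a - 1"] a \<open>a \<noteq> {}\<close>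
    by (simp add: card_gt_0_iff Suc_leI)
  then have "tree_pred a = ?b"
    unfolding tree_pred_def by (rule the_equality) (use tree_succ_unique \<open>tree_succ ?b a\<close> in blast)
  then show "tree_pred a \<in> Fpow UNIV" by (simp add: Fpow_def)
qed (auto simp: Fpow_def)

lemma full_tree_has_branch:
  assumes "full_tree T"
  shows "\<exists>\<beta>. is_branch T \<beta>"
proof -
  have "\<exists>\<beta>. \<forall>n. (\<beta> n \<in> T \<and> (n = 0 \<longrightarrow> \<beta> n = {})) \<and> tree_succ (\<beta> n) (\<beta> (Suc n))"
  proof (rule dependent_nat_choice)
    fix a and n :: nat assume "a \<in> T \<and> (n = 0 \<longrightarrow> a = {})"
    then have "infinite (successors T a)" using assms by (simp add: full_tree_def)
    then obtain b where "b \<in> successors T a" using infinite_imp_nonempty by blast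
    then show "\<exists>b. (b \<in> T \<and> (Suc n = 0 \<longrightarrow> b = {})) \<and> tree_succ a b"
      by (auto simp: successors_def)
  qed (use assms in \<open>auto simp: full_tree_def\<close>)
  then obtain \<beta> where "\<And>n. (\<beta> n \<in> T \<and> (n = 0 \<longrightarrow> \<beta> n = {})) \<and> tree_succ (\<beta> n) (\<beta> (Suc n))"
    by blast
  then have "is_branch T \<beta>" unfolding is_branch_def by blast
  then show ?thesis by blast
qed

text \<open>A branch consists of the initial segments of one sequence, so the condition of
  \<open>null_list_tree\<close> on sequences \<open>s\<close> applies to it.\<close>

lemma branch_enumeration:
  assumes "is_branch S \<beta>"
  shows "\<exists>s. \<forall>k. sorted_list_of_set (\<beta> k) = map s [0..<k]"
proof -
  have "\<exists>n. sorted_list_of_set (\<beta> (Suc k)) = sorted_list_of_set (\<beta> k) @ [n]" for k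
    using assms by (auto simp: is_branch_def intro: tree_succ_imp_append)
  then obtain s where s: "\<And>k. sorted_list_of_set (\<beta> (Suc k)) = sorted_list_of_set (\<beta> k) @ [s k]"
    by metis
  have "sorted_list_of_set (\<beta> k) = map s [0..<k]" for k
  proof (induction k)
    case 0
    then show ?case using assms by (simp add: is_branch_def)
  qed (simp add: s)
  then show ?thesis by blast
qed

lemma branch_inj:
  assumes "is_branch S \<beta>"
  shows "inj \<beta>"
proof (rule injI)
  fix i j assume eq: "\<beta> i = \<beta> j"
  obtain s where "\<And>k. sorted_list_of_set (\<beta> k) = map s [0..<k]"
    using branch_enumeration[OF assms] by blast
  then have "map s [0..<i] = map s [0..<j]" using eq by metis
  then have "length (map s [0..<i]) = length (map s [0..<j])" by (rule arg_cong)
  then show "i = j" by simp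
qed

lemma sum_over_branch:
  fixes f :: "nat set \<Rightarrow> 'b::ab_group_add"
  assumes "is_branch S \<beta>" "\<And>k. k \<ge> M \<Longrightarrow> f (\<beta> k) = 0"
  shows "finite {a \<in> range \<beta>. f a \<noteq> 0}" "sum' f (range \<beta>) = (\<Sum>k<M. f (\<beta> k))"
proof -
  have sub: "{a \<in> range \<beta>. f a \<noteq> 0} \<subseteq> \<beta> ` {..<M}"
    using assms(2) by (force simp: not_less[symmetric])
  then show "finite {a \<in> range \<beta>. f a \<noteq> 0}" by (rule finite_subset) simp
  have "sum' f (range \<beta>) = sum' f (\<beta> ` {..<M})"
    by (rule sum.mono_neutral_right') (use sub in auto)
  also have "\<dots> = sum f (\<beta> ` {..<M})" by (rule sum.eq_sum) simp
  also have "\<dots> = (\<Sum>k<M. f (\<beta> k))"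
    using branch_inj[OF assms(1)] by (subst sum.reindex) (auto intro: inj_on_subset)
  finally show "sum' f (range \<beta>) = (\<Sum>k<M. f (\<beta> k))" .
qed

text \<open>The strong operator topology is pulled back from the product topology, where convergence
  is coordinatewise.\<close>

lemma limitin_weak_star_topology:
  fixes x :: "'i \<Rightarrow> ('a::real_normed_vector \<Rightarrow>\<^sub>L real)"
  assumes "\<And>u. ((\<lambda>i. blinfun_apply (x i) u) \<longlongrightarrow> blinfun_apply l u) F"
  shows "limitin weak_star_topology x l F"
  unfolding limitin_def weak_star_topology_def
proof (intro conjI allI impI)
  fix U assume "openin strong_operator_topology U \<and> l \<in> U"
  then obtain V where V: "open V" "U = blinfun_apply -` V" "blinfun_apply l \<in> V"
    by (auto simp: strong_operator_topology_def openin_pullback_topology)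
  have "((\<lambda>i. blinfun_apply (x i)) \<longlongrightarrow> blinfun_apply l) F"
    using assms
    unfolding limitin_canonical_iff[symmetric] euclidean_product_topology[symmetric] limitin_componentwise
    by simp
  then show "\<forall>\<^sub>F i in F. x i \<in> U" using V by (auto simp: tendsto_def)
qed (simp add: strong_operator_topology_topspace)

text \<open>Read along increasing enumerations, \<open>F\<close> is a weak*-null tree-map. On a
  branch of the subtree for \<epsilon> = 1, with S the sum of the increments and V that of their
  norms, c * V - 1 < norm S \<le> norm (x + S) + norm x \<le> r + c * V + 2.\<close>

lemma tree_bound_lower:
  fixes x :: "'a::real_normed_vector \<Rightarrow>\<^sub>L real"
  assumes property: "weak_star_summable_tree_property_with TYPE('a) c" and tb: "tree_bound c x r"
  shows "-3 \<le> r"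
proof -
  obtain F where F: "null_list_tree c x r F"
    using tree_bound_imp_null_list_tree[OF tb] by blast
  define X where "X a = F (sorted_list_of_set a)" for a
  have X_branch: "\<exists>M. (\<forall>k\<ge>M. X (\<beta> k) = 0) \<and>
      norm (x + (\<Sum>k<M. X (\<beta> k))) \<le> r + c * (\<Sum>k<M. norm (X (\<beta> k)))" if br: "is_branch S \<beta>" for S \<beta>
  proof -
    obtain s where s: "\<And>k. sorted_list_of_set (\<beta> k) = map s [0..<k]"
      using branch_enumeration[OF br] by blast
    show ?thesis using F unfolding null_list_tree_def X_def s by blast
  qed
  have "tree_map (Fpow UNIV) X"
    unfolding tree_map_def
  proof (intro conjI full_tree_Fpow allI impI)
    show "X {} = 0" using F by (simp add: X_def null_list_tree_def)
    fix \<beta> assume "is_branch (Fpow UNIV) \<beta>"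
    from X_branch[OF this] obtain M where "\<And>k. k \<ge> M \<Longrightarrow> X (\<beta> k) = 0" by blast
    then show "finite {a \<in> range \<beta>. X a \<noteq> 0}"
      by (rule sum_over_branch(1)[OF \<open>is_branch (Fpow UNIV) \<beta>\<close>])
  qed
  moreover have "weak_star_null (Fpow UNIV) X"
    unfolding weak_star_null_def
  proof (intro ballI limitin_weak_star_topology tendstoI)
    fix a :: "nat set" and u :: 'a and e :: real assume "a \<in> Fpow UNIV" "e > 0"
    define B where "B = {n. \<not> \<bar>F (sorted_list_of_set a @ [n]) u\<bar> < e}"
    have "(\<lambda>n. F (sorted_list_of_set a @ [n]) u) \<longlonglongrightarrow> 0"
      using F by (simp add: null_list_tree_def)
    then have "eventually (\<lambda>n. \<bar>F (sorted_list_of_set a @ [n]) u\<bar> < e) sequentially"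
      using \<open>e > 0\<close> by (auto dest: tendstoD[of _ 0 _ e])
    then have "finite B"
      by (simp add: B_def cofinite_eq_sequentially[symmetric] eventually_cofinite)
    \<comment> \<open>A successor is determined by the number it appends, so finitely many bad
      numbers leave finitely many bad successors; this passes from sequential limits to the cofinite
      filter.\<close>
    have "{b. \<not> (b \<in> successors (Fpow UNIV) a \<longrightarrow> dist (X b u) (blinfun_apply 0 u) < e)}
        \<subseteq> (\<lambda>n. set (sorted_list_of_set a @ [n])) ` B"
    proof
      fix b assume "b \<in> {b. \<not> (b \<in> successors (Fpow UNIV) a \<longrightarrow> dist (X b u) (blinfun_apply 0 u) < e)}"
      then have b: "tree_succ a b" "\<not> \<bar>X b u\<bar> < e" by (auto simp: successors_def)
      obtain n where n: "sorted_list_of_set b = sorted_list_of_set a @ [n]"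
        using tree_succ_imp_append[OF b(1)] by blast
      have "set (sorted_list_of_set b) = b" using tree_succ_finite[OF b(1)] by simp
      moreover have "n \<in> B" using b(2) by (simp add: B_def X_def n)
      ultimately show "b \<in> (\<lambda>n. set (sorted_list_of_set a @ [n])) ` B" by (auto simp only: n)
    qed
    with \<open>finite B\<close>
    have "finite {b. \<not> (b \<in> successors (Fpow UNIV) a \<longrightarrow> dist (X b u) (blinfun_apply 0 u) < e)}"
      by (meson finite_imageI finite_subset)
    then show "eventually (\<lambda>b. dist (X b u) (blinfun_apply 0 u) < e)
        (inf cofinite (principal (successors (Fpow UNIV) a)))"
      by (simp only: eventually_inf_principal eventually_cofinite)
  qed
  moreover have "bdd_above ((\<lambda>a. norm (\<Sum>b | b \<in> Fpow UNIV \<and> tree_le b a. X b)) ` Fpow UNIV)"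
  proof (rule bdd_aboveI2)
    fix a :: "nat set" assume "a \<in> Fpow UNIV"
    then have a: "finite a" by (simp add: Fpow_def)
    have inj: "inj_on (\<lambda>k. set (take k (sorted_list_of_set a))) {..card a}"
      using tree_le_set_take(3)[OF a] by (intro inj_onI) (metis atMost_iff min.absorb1)
    have "(\<Sum>b | b \<in> Fpow UNIV \<and> tree_le b a. X b) = (\<Sum>k\<le>card a. F (take k (sorted_list_of_set a)))"
      unfolding tree_le_predecessors[OF a] sum.reindex[OF inj]
      by (simp add: X_def tree_le_set_take(2)[OF a])
    moreover have "norm (x + (\<Sum>k\<le>card a. F (take k (sorted_list_of_set a)))) \<le> 2"
      using F unfolding null_list_tree_def by (metis length_sorted_list_of_set)
    ultimately show "norm (\<Sum>b | b \<in> Fpow UNIV \<and> tree_le b a. X b) \<le> 2 + norm x"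
      using norm_triangle_ineq4[of "x + (\<Sum>b | b \<in> Fpow UNIV \<and> tree_le b a. X b)" x] by simp
  qed
  ultimately obtain T where T: "full_tree T"
    "\<And>\<beta>. is_branch T \<beta> \<Longrightarrow>
       norm (sum' X (range \<beta>)) > c * sum' (\<lambda>a. norm (X a)) (range \<beta>) - 1"
    using property[unfolded weak_star_summable_tree_property_with_def, rule_format, of "Fpow UNIV" X 1] by auto
  obtain \<beta> where \<beta>: "is_branch T \<beta>" using full_tree_has_branch[OF T(1)] by blast
  obtain M where M: "\<And>k. k \<ge> M \<Longrightarrow> X (\<beta> k) = 0"
    "norm (x + (\<Sum>k<M. X (\<beta> k))) \<le> r + c * (\<Sum>k<M. norm (X (\<beta> k)))"
    using X_branch[OF \<beta>] by blast
  have "norm (\<Sum>k<M. X (\<beta> k)) > c * (\<Sum>k<M. norm (X (\<beta> k))) - 1"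
    using T(2)[OF \<beta>] sum_over_branch(2)[OF \<beta>, of M X] sum_over_branch(2)[OF \<beta>, of M "\<lambda>a. norm (X a)"] M(1)
    by simp
  moreover have "norm (\<Sum>k<M. X (\<beta> k)) \<le> norm (x + (\<Sum>k<M. X (\<beta> k))) + norm x"
    using norm_triangle_ineq4[of "x + (\<Sum>k<M. X (\<beta> k))" x] by simp
  ultimately show ?thesis using M(2) tree_bound_norm[OF tb] by linarith
qed

subsection \<open>The value of a functional\<close>

text \<open>The set contains \<open>norm x\<close> on the ball of radius 2 and is empty outside it,
  which explains the norm bounds in the locale below.\<close>

definition tree_value :: "real \<Rightarrow> ('a::real_normed_vector \<Rightarrow>\<^sub>L real) \<Rightarrow> real" where
  "tree_value c x = Inf {r. tree_bound c x r}"

text \<open>Separates the trees from the construction of the embedding, which uses only these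
  properties of the value.\<close>

locale weak_star_growth =
  fixes N :: "('a::real_normed_vector \<Rightarrow>\<^sub>L real) \<Rightarrow> real" and c :: real and u :: "nat \<Rightarrow> 'a"
  assumes c_pos: "c > 0"
    and dense: "closure (range u) = UNIV"
    and lower: "norm x \<le> 2 \<Longrightarrow> -3 \<le> N x"
    and upper: "norm x \<le> 2 \<Longrightarrow> N x \<le> norm x"
    and growth: "norm x \<le> 2 \<Longrightarrow> (\<And>n. norm (z n) \<le> 2) \<Longrightarrow>
      (\<And>v. (\<lambda>n. blinfun_apply (z n) v) \<longlonglongrightarrow> blinfun_apply x v) \<Longrightarrow> 0 < e \<Longrightarrow>
      \<exists>n. N x + c * norm (z n - x) - e \<le> N (z n)"
    and near_lipschitz: "norm x \<le> 1 \<Longrightarrow> norm (y - x) \<le> 1 \<Longrightarrow> N y \<le> N x + 5 * norm (y - x)"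

text \<open>If all \<open>z n\<close> violated \<open>growth\<close>, their trees could be grafted
  onto \<open>x\<close> and would push its value below itself. For \<open>near_lipschitz\<close>,
  contraction towards a point \<open>q\<close> replaces \<open>r\<close> by (1 - s) * r + s * 2, at
  a cost s * (2 - r) \<le> 5 * s since r \<ge> -3.\<close>

lemma weak_star_growth_tree_value:
  fixes u :: "nat \<Rightarrow> 'a::real_normed_vector"
  assumes property: "weak_star_summable_tree_property_with TYPE('a) c" and c: "c > 0"
    and u: "closure (range u) = UNIV"
  shows "weak_star_growth (tree_value c :: ('a \<Rightarrow>\<^sub>L real) \<Rightarrow> real) c u"
proof
  have low: "-3 \<le> r" if "tree_bound c x r" for x :: "'a \<Rightarrow>\<^sub>L real" and r
    using tree_bound_lower[OF property that] .
  then have bdd: "bdd_below {r. tree_bound c x r}" for x :: "'a \<Rightarrow>\<^sub>L real"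
    by (intro bdd_belowI) auto
  have mem: "norm x \<in> {r. tree_bound c x r}" if "norm x \<le> 2" for x :: "'a \<Rightarrow>\<^sub>L real"
    using that by (auto intro: tree_bound.leaf)
  have le: "tree_value c x \<le> r" if "tree_bound c x r" for x :: "'a \<Rightarrow>\<^sub>L real" and r
    unfolding tree_value_def using that by (intro cInf_lower bdd) simp
  have ex: "tree_bound c x r" if x: "norm x \<le> 2" and r: "tree_value c x < r" for x :: "'a \<Rightarrow>\<^sub>L real" and r
  proof -
    obtain s where "s \<in> {r. tree_bound c x r}" "s < r"
      using cInf_lessD[of "{r. tree_bound c x r}" r] mem[OF x] r
      unfolding tree_value_def by blast
    then show ?thesis using tree_bound_mono[of c x s r] by simp
  qed
  show "0 < c" by fact
  show "closure (range u) = UNIV" by fact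
  fix x :: "'a \<Rightarrow>\<^sub>L real"
  {
    assume x: "norm x \<le> 2"
    show "-3 \<le> tree_value c x"
      unfolding tree_value_def using mem[OF x] low by (intro cInf_greatest) auto
    show "tree_value c x \<le> norm x" using mem[OF x] le by simp
    fix z :: "nat \<Rightarrow> 'a \<Rightarrow>\<^sub>L real" and e :: real
    assume z: "\<And>n. norm (z n) \<le> 2" "\<And>v. (\<lambda>n. blinfun_apply (z n) v) \<longlonglongrightarrow> blinfun_apply x v"
      and e: "0 < e"
    show "\<exists>n. tree_value c x + c * norm (z n - x) - e \<le> tree_value c (z n)"
    proof (rule ccontr)
      assume "\<not> ?thesis"
      then have "tree_value c (z n) < tree_value c x - e + c * norm (z n - x)" for n
        by (simp add: not_le algebra_simps)
      then have "tree_bound c x (tree_value c x - e)"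
        using x z by (intro tree_bound.node[of x z] ex) auto
      from le[OF this] e show False by simp
    qed
  }
  fix y :: "'a \<Rightarrow>\<^sub>L real"
  assume x: "norm x \<le> 1" and yx: "norm (y - x) \<le> 1"
  define s where "s = norm (y - x)"
  show "tree_value c y \<le> tree_value c x + 5 * norm (y - x)"
  proof (cases "y = x")
    case False
    then have s: "0 < s" "s \<le> 1" using yx by (auto simp: s_def)
    \<comment> \<open>The point at distance 1 from \<open>x\<close> on the ray through
      \<open>y\<close>: it stays in the ball of radius 2, and contraction by \<open>s\<close>
      towards it takes \<open>x\<close> to \<open>y\<close>.\<close>
    define q where "q = x + (1 / s) *\<^sub>R (y - x)"
    have "norm ((1 / s) *\<^sub>R (y - x)) = 1" using s by (simp add: s_def)
    then have q: "norm q \<le> 2"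
      unfolding q_def using norm_triangle_ineq[of x "(1 / s) *\<^sub>R (y - x)"] x by linarith
    have y: "(1 - s) *\<^sub>R x + s *\<^sub>R q = y" using s by (simp add: q_def algebra_simps)
    have "tree_value c y - 5 * s \<le> r" if r: "tree_bound c x r" for r
    proof -
      have "tree_value c y \<le> (1 - s) * r + s * 2"
        using tree_bound_convex[OF r q, of s] s by (intro le) (simp add: y)
      also have "\<dots> \<le> r + 5 * s"
        using mult_left_mono[OF low[OF r], of s] s by (simp add: algebra_simps)
      finally show ?thesis by simp
    qed
    then have "tree_value c y - 5 * s \<le> tree_value c x"
      unfolding tree_value_def[of c x] using mem[of x] x by (intro cInf_greatest) auto
    then show ?thesis by (simp add: s_def)
  qed simp
qed

section \<open>Closeness on initial segments of the dense sequence, and finite sets of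
  guesses\<close>

context weak_star_growth
begin

text \<open>The tolerance shrinks as the segment grows, so closeness on ever longer segments gives
  weak* convergence of bounded sequences. The factor \<open>r\<close> leaves room for triangle
  inequalities: 1/2 for the nets, 1 for guesses of a functional, 2 for two guesses of the same
  functional.\<close>

definition close :: "real \<Rightarrow> nat \<Rightarrow> ('a \<Rightarrow>\<^sub>L real) \<Rightarrow> ('a \<Rightarrow>\<^sub>L real) \<Rightarrow> bool" where
  "close r m x y \<longleftrightarrow> (\<forall>i<m. \<bar>blinfun_apply x (u i) - blinfun_apply y (u i)\<bar> \<le> r / (real m + 1))"

lemma close_mono:
  assumes "close r m x y" "k \<le> m" "r / (real m + 1) \<le> s / (real k + 1)"
  shows "close s k x y"
  unfolding close_def
proof (intro allI impI)
  fix i assume "i < k"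
  then have "\<bar>x (u i) - y (u i)\<bar> \<le> r / (real m + 1)" using assms(1,2) by (simp add: close_def)
  then show "\<bar>x (u i) - y (u i)\<bar> \<le> s / (real k + 1)" using assms(3) by (rule order_trans)
qed

lemma close_mono_index: "close r m x y \<Longrightarrow> k \<le> m \<Longrightarrow> 0 \<le> r \<Longrightarrow> close r k x y"
  by (erule close_mono) (auto intro!: divide_left_mono)

lemma close_triangle:
  assumes "close r m x y" "close s m y z"
  shows "close (r + s) m x z"
  unfolding close_def
proof (intro allI impI)
  fix i assume "i < m"
  then have "\<bar>x (u i) - y (u i)\<bar> \<le> r / (real m + 1)" "\<bar>y (u i) - z (u i)\<bar> \<le> s / (real m + 1)"
    using assms by (auto simp: close_def)
  then show "\<bar>x (u i) - z (u i)\<bar> \<le> (r + s) / (real m + 1)"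
    unfolding add_divide_distrib by linarith
qed

lemma close_sym: "close r m x y \<Longrightarrow> close r m y x"
  by (simp add: close_def abs_minus_commute)

lemma close_tendsto:
  assumes "\<And>n. norm (f n) \<le> b" "\<And>n. close 1 (m n) (f n) x" "\<And>n. n \<le> m n"
  shows "(\<lambda>n. blinfun_apply (f n) v) \<longlonglongrightarrow> blinfun_apply x v"
proof (rule blinfun_tendsto_dense[OF dense assms(1)])
  fix w assume "w \<in> range u"
  then obtain i where w: "w = u i" by blast
  have "\<bar>f n w - x w\<bar> \<le> 1 / (real n + 1)" if "n > i" for n
  proof -
    have "\<bar>f n w - x w\<bar> \<le> 1 / (real (m n) + 1)"
      using assms(2)[of n] assms(3)[of n] that by (simp add: close_def w)
    also have "\<dots> \<le> 1 / (real n + 1)" using assms(3)[of n] by (intro divide_left_mono) auto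
    finally show ?thesis .
  qed
  then have "eventually (\<lambda>n. norm (f n w - x w) \<le> 1 / (real n + 1)) sequentially"
    unfolding eventually_at_top_dense by (intro exI[of _ i]) auto
  moreover have "(\<lambda>n. 1 / (real n + 1)) \<longlonglongrightarrow> 0"
    using LIMSEQ_inverse_real_of_nat by (simp add: field_simps)
  ultimately have "(\<lambda>n. f n w - x w) \<longlonglongrightarrow> 0" by (rule Lim_null_comparison)
  then show "(\<lambda>n. f n w) \<longlonglongrightarrow> x w" by (simp add: LIM_zero_iff)
qed

text \<open>Violations at every \<open>M\<close> would form a sequence tending weak* to
  \<open>y\<close>, contrary to \<open>growth\<close>; the sequential property thus holds on a whole
  neighbourhood.\<close>

lemma growth_near:
  assumes "norm y \<le> 2" "0 < e"
  shows "\<exists>M. \<forall>z. norm z \<le> 2 \<longrightarrow> close 1 M z y \<longrightarrow> N y + c * norm (z - y) - e \<le> N z"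
proof (rule ccontr)
  assume "\<not> ?thesis"
  then obtain z where z: "\<And>M. norm (z M) \<le> 2" "\<And>M. close 1 M (z M) y"
    "\<And>M. \<not> N y + c * norm (z M - y) - e \<le> N (z M)" by metis
  have "\<exists>n. N y + c * norm (z n - y) - e \<le> N (z n)"
    by (rule growth[OF assms(1) z(1) _ assms(2)]) (rule close_tendsto[OF z(1,2)], simp)
  with z(3) show False by blast
qed

text \<open>Functionals are coloured by the rounded values that matter; one representative per colour suffices.\<close>

lemma finite_net:
  "\<exists>E. finite E \<and> E \<subseteq> cball 0 1 \<and>
     (\<forall>x\<in>cball 0 1. \<exists>y\<in>E. close (1/2) m x y \<and> N y \<le> N x + 1 / (real m + 1))"
proof -
  \<comment> \<open>Numbers with equal floors at scale k differ by at most 1 / k: the scale 2 * (m +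
    1) yields \<open>close (1/2)\<close>, the scale m + 1 the precision for
    \<open>N\<close>.\<close>
  define col where "col x = (\<lambda>i\<in>{..<m}. \<lfloor>2 * (real m + 1) * x (u i)\<rfloor>, \<lfloor>(real m + 1) * N x\<rfloor>)"
    for x :: "'a \<Rightarrow>\<^sub>L real"
  define b where "b i = \<lceil>2 * (real m + 1) * norm (u i)\<rceil>" for i
  define b' where "b' = \<lceil>(real m + 1) * 3\<rceil>"
  have "col x \<in> (\<Pi>\<^sub>E i\<in>{..<m}. {- b i..b i}) \<times> {- b'..b'}" if "x \<in> cball 0 1" for x
  proof -
    have x: "norm x \<le> 1" using that by simp
    have "\<bar>x (u i)\<bar> \<le> norm (u i)" for i
      using norm_blinfun[of x "u i"] mult_right_mono[OF x norm_ge_zero[of "u i"]] by simp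
    then have "\<bar>2 * (real m + 1) * x (u i)\<bar> \<le> 2 * (real m + 1) * norm (u i)" for i
      by (simp add: abs_mult mult_left_mono)
    then have "\<bar>2 * (real m + 1) * x (u i)\<bar> \<le> b i" for i
      unfolding b_def by (meson le_of_int_ceiling order_trans)
    then have "\<lfloor>2 * (real m + 1) * x (u i)\<rfloor> \<in> {- b i..b i}" for i
      by (simp add: le_floor_iff floor_le_iff abs_le_iff) (smt (verit))
    moreover have "\<bar>N x\<bar> \<le> 3" using lower[of x] upper[of x] x by linarith
    then have "\<bar>(real m + 1) * N x\<bar> \<le> (real m + 1) * 3"
      unfolding abs_mult by (intro mult_mono) auto
    then have "\<bar>(real m + 1) * N x\<bar> \<le> b'"
      unfolding b'_def by (meson le_of_int_ceiling order_trans)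
    then have "\<lfloor>(real m + 1) * N x\<rfloor> \<in> {- b'..b'}"
      by (simp add: le_floor_iff floor_le_iff abs_le_iff)
    ultimately show ?thesis by (auto simp: col_def)
  qed
  then have "col ` cball 0 1 \<subseteq> (\<Pi>\<^sub>E i\<in>{..<m}. {- b i..b i}) \<times> {- b'..b'}" by blast
  moreover have "finite ((\<Pi>\<^sub>E i\<in>{..<m}. {- b i..b i}) \<times> {- b'..b'})"
    by (intro finite_cartesian_product finite_PiE) auto
  ultimately have "finite (col ` cball 0 1)" by (rule finite_subset)
  from finite_subset_image[OF this order_refl]
  obtain E where E: "E \<subseteq> cball 0 1" "finite E" "col ` cball 0 1 = col ` E" by blast
  have "\<exists>y\<in>E. close (1/2) m x y \<and> N y \<le> N x + 1 / (real m + 1)" if "x \<in> cball 0 1" for x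
  proof -
    have "col x \<in> col ` E" using that E(3) by blast
    then obtain y where y: "y \<in> E" "col y = col x" by force
    have fl: "\<bar>a - b\<bar> \<le> 1 / k" if "k > 0" "\<lfloor>k * a\<rfloor> = \<lfloor>k * b\<rfloor>" for a b k :: real
    proof -
      have "\<bar>k * a - k * b\<bar> < 1" using that(2) by linarith
      also have "\<bar>k * a - k * b\<bar> = k * \<bar>a - b\<bar>"
        using that(1) by (simp only: right_diff_distrib[symmetric] abs_mult abs_of_pos)
      finally show ?thesis using that(1) by (simp add: pos_le_divide_eq mult.commute)
    qed
    have "close (1/2) m x y"
      unfolding close_def
    proof (intro allI impI)
      fix i assume "i < m"
      then have "\<lfloor>2 * (real m + 1) * x (u i)\<rfloor> = \<lfloor>2 * (real m + 1) * y (u i)\<rfloor>"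
        using fun_cong[OF arg_cong[OF y(2), of fst], of i] by (simp add: col_def)
      from fl[OF _ this] show "\<bar>x (u i) - y (u i)\<bar> \<le> 1 / 2 / (real m + 1)" by simp
    qed
    moreover have "\<lfloor>(real m + 1) * N x\<rfloor> = \<lfloor>(real m + 1) * N y\<rfloor>"
      using y(2) by (simp add: col_def)
    from fl[OF _ this] have "\<bar>N x - N y\<bar> \<le> 1 / (real m + 1)" by simp
    then have "N y \<le> N x + 1 / (real m + 1)" by linarith
    ultimately show ?thesis using y(1) by blast
  qed
  with E show ?thesis by blast
qed

text \<open>The growth \<open>4 ^ t\<close> makes the guesses so precise that their differences remain small on the dense
  sequence after division by \<open>(1/2) ^ j\<close>.\<close>

lemma guesses:
  obtains m E where "strict_mono m" "\<And>t. 4 ^ t \<le> real (m t) + 1"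
    and "\<And>t. finite (E t)" "\<And>t. E t \<subseteq> cball 0 1"
    and "\<And>t x. x \<in> cball 0 1 \<Longrightarrow>
      \<exists>y\<in>E t. close (1/2) (m t) x y \<and> N y \<le> N x + 1 / (real (m t) + 1)"
    and "\<And>t y z. y \<in> E t \<Longrightarrow> norm z \<le> 2 \<Longrightarrow> close 2 (m (Suc t)) z y \<Longrightarrow>
      N y + c * norm (z - y) - (1/2) ^ t \<le> N z"
proof -
  obtain E where E: "\<And>m. finite (E m)" "\<And>m. E m \<subseteq> cball 0 1"
    "\<And>m x. x \<in> cball 0 1 \<Longrightarrow> \<exists>y\<in>E m. close (1/2) m x y \<and> N y \<le> N x + 1 / (real m + 1)"
    using finite_net by metis
  have "\<exists>M. \<forall>y\<in>E m. \<forall>z. norm z \<le> 2 \<longrightarrow> close 1 M z y \<longrightarrow> N y + c * norm (z - y) - (1/2) ^ t \<le> N z"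
    for m t :: nat
  proof -
    have "\<exists>M. \<forall>z. norm z \<le> 2 \<longrightarrow> close 1 M z y \<longrightarrow> N y + c * norm (z - y) - (1/2) ^ t \<le> N z"
      if "y \<in> E m" for y
      using that E(2)[of m] by (intro growth_near) (auto simp: subset_iff intro: order_trans)
    then obtain M where M: "\<And>y z. y \<in> E m \<Longrightarrow> norm z \<le> 2 \<Longrightarrow> close 1 (M y) z y \<Longrightarrow>
        N y + c * norm (z - y) - (1/2) ^ t \<le> N z" by metis
    \<comment> \<open>The sum serves as a common upper bound of the finitely many
      \<open>M y\<close>.\<close>
    have "close 1 (M y) z y" if "y \<in> E m" "close 1 (\<Sum>y\<in>E m. M y) z y" for y z
      using that member_le_sum[of y "E m" M] E(1) by (intro close_mono_index[OF that(2)]) auto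
    with M show ?thesis by blast
  qed
  then obtain M where M: "\<And>m t y z. y \<in> E m \<Longrightarrow> norm z \<le> 2 \<Longrightarrow> close 1 (M m t) z y \<Longrightarrow>
      N y + c * norm (z - y) - (1/2) ^ t \<le> N z" by metis
  \<comment> \<open>The factor 4 and the summand \<open>M k t\<close> turn \<open>close 2\<close> at
    the next stage into \<open>close 1\<close> at \<open>M k t\<close>; the factor also gives the
    growth \<open>4 ^ t\<close>.\<close>
  define m where "m = rec_nat 0 (\<lambda>t k. 4 * (M k t + k + 1))"
  have m: "m (Suc t) = 4 * (M (m t) t + m t + 1)" for t by (simp add: m_def)
  have m4: "4 ^ t \<le> real (m t) + 1" for t
  proof (induction t)
    case (Suc t)
    have "(4::real) ^ Suc t \<le> 4 * (real (m t) + 1)" using Suc by simp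
    also have "\<dots> \<le> real (m (Suc t)) + 1" by (simp add: m)
    finally show ?case .
  qed simp
  have near: "N y + c * norm (z - y) - (1/2) ^ t \<le> N z"
    if y: "y \<in> E (m t)" and z: "norm z \<le> 2" and cl: "close 2 (m (Suc t)) z y" for t y z
  proof (rule M[OF y z], rule close_mono[OF cl])
    show "M (m t) t \<le> m (Suc t)" by (simp add: m)
    show "2 / (real (m (Suc t)) + 1) \<le> 1 / (real (M (m t) t) + 1)"
      by (simp add: m field_simps)
  qed
  show ?thesis
  proof (rule that[of m "\<lambda>t. E (m t)"])
    show "strict_mono m" by (rule strict_monoI_Suc) (simp add: m)
  qed (fact E m4 near)+
qed

text \<open>Otherwise a weak\<open>*\<close> limit of counterexamples would have guesses that keep changing by more than \<open>e\<close>,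
  although \<open>N\<close> being almost minimal at the guesses forces them to converge in norm.\<close>

lemma small_change:
  assumes m: "strict_mono m"
    and E: "\<And>t. E t \<subseteq> cball 0 1"
    and net: "\<And>t x. x \<in> cball 0 1 \<Longrightarrow>
      \<exists>y\<in>E t. close (1/2) (m t) x y \<and> N y \<le> N x + 1 / (real (m t) + 1)"
    and e: "0 < e"
  shows "\<exists>L>k. \<forall>x\<in>cball 0 1. \<exists>t y y'. k \<le> t \<and> t < L \<and> y \<in> E t \<and> y' \<in> E (Suc t) \<and>
    close 1 (m t) x y \<and> close 1 (m (Suc t)) x y' \<and> norm (y' - y) \<le> e"
proof (rule ccontr)
  assume "\<not> ?thesis"
  then have "\<forall>L. \<exists>x. k < L \<longrightarrow> x \<in> cball 0 1 \<and> \<not> (\<exists>t y y'. k \<le> t \<and> t < L \<and> y \<in> E t \<and>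
      y' \<in> E (Suc t) \<and> close 1 (m t) x y \<and> close 1 (m (Suc t)) x y' \<and> norm (y' - y) \<le> e)"
    by blast
  then obtain X where X: "\<And>L. k < L \<Longrightarrow> X L \<in> cball 0 1"
    and bad: "\<And>L t y y'. k < L \<Longrightarrow> k \<le> t \<Longrightarrow> t < L \<Longrightarrow> y \<in> E t \<Longrightarrow> y' \<in> E (Suc t) \<Longrightarrow>
      close 1 (m t) (X L) y \<Longrightarrow> close 1 (m (Suc t)) (X L) y' \<Longrightarrow> \<not> norm (y' - y) \<le> e"
    by metis
  have "norm (X (Suc k + n)) \<le> 1" for n using X[of "Suc k + n"] by simp
  then obtain r x where r: "strict_mono (r :: nat \<Rightarrow> nat)" and x: "norm x \<le> 1"
    and lim: "\<And>v. (\<lambda>n. blinfun_apply (X (Suc k + r n)) v) \<longlonglongrightarrow> blinfun_apply x v"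
    using weak_star_convergent_subsequence[OF _ dense, of "\<lambda>n. X (Suc k + n)" 1] by auto
  have "x \<in> cball 0 1" using x by simp
  then obtain y where y: "\<And>t. y t \<in> E t" "\<And>t. close (1/2) (m t) x (y t)"
    "\<And>t. N (y t) \<le> N x + 1 / (real (m t) + 1)" using net[of x] by metis
  have ny: "norm (y t) \<le> 2" for t using y(1)[of t] E[of t] by (auto simp: subset_iff intro: order_trans)
  obtain M where M: "\<And>z. norm z \<le> 2 \<Longrightarrow> close 1 M z x \<Longrightarrow> N x + c * norm (z - x) - c * e / 4 \<le> N z"
    using growth_near[of x "c * e / 4"] x e c_pos by auto
  obtain K :: nat where K: "4 / (c * e) < real K" using reals_Archimedean2 by blast
  \<comment> \<open>Growth near \<open>x\<close> bounds \<open>N (y t)\<close> from below by N x + c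
    * norm (y t - x) - c * e / 4, the net bounds it from above by nearly \<open>N x\<close>;
    comparison forces norm convergence of the guesses.\<close>
  have near: "norm (y t - x) \<le> e / 2" if t: "t \<ge> M" "t \<ge> K" for t
  proof -
    have mt: "t \<le> m t" using m by (rule strict_mono_imp_increasing)
    have "close 1 M (y t) x"
    proof (rule close_mono[OF close_sym[OF y(2)]])
      show "M \<le> m t" using mt t by simp
      show "1 / 2 / (real (m t) + 1) \<le> 1 / (real M + 1)" using mt t by (simp add: field_simps)
    qed
    then have "c * norm (y t - x) \<le> c * e / 4 + 1 / (real (m t) + 1)"
      using M[OF ny] y(3)[of t] by fastforce
    also have "1 / (real (m t) + 1) \<le> c * e / 4"
    proof -
      have "4 / (c * e) \<le> real (m t) + 1" using K mt t by linarith
      then show ?thesis using c_pos e by (simp add: field_simps)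
    qed
    finally have "c * norm (y t - x) \<le> c * (e / 2)" by simp
    then show ?thesis using c_pos by simp
  qed
  define t where "t = max k (max M K)"
  have t: "k \<le> t" "M \<le> t" "K \<le> t" by (auto simp: t_def)
  have "norm (y (Suc t) - x) \<le> e / 2" "norm (y t - x) \<le> e / 2" using near t by simp_all
  then have small: "norm (y (Suc t) - y t) \<le> e"
    using norm_triangle_ineq4[of "y (Suc t) - x" "y t - x"] by simp
  \<comment> \<open>The tolerance of \<open>close (1/2)\<close> at the finer of the stages
    \<open>t\<close> and \<open>Suc t\<close>. Adding the 1/2 between \<open>x\<close> and its
    guesses makes \<open>y t\<close> and \<open>y (Suc t)\<close> admissible guesses for
    \<open>X L\<close>.\<close>
  define s where "s = 1/2 / (real (m (Suc t)) + 1)"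
  have "s > 0" by (simp add: s_def)
  then have "eventually (\<lambda>n. \<bar>X (Suc k + r n) (u i) - x (u i)\<bar> < s) sequentially" for i
    using tendstoD[OF lim[of "u i"]] by (simp add: dist_real_def)
  then have "eventually (\<lambda>n. \<forall>i\<in>{..<m (Suc t)}. \<bar>X (Suc k + r n) (u i) - x (u i)\<bar> < s) sequentially"
    by (intro eventually_ball_finite) auto
  then obtain n0 where n0: "\<And>n i. n \<ge> n0 \<Longrightarrow> i < m (Suc t) \<Longrightarrow> \<bar>X (Suc k + r n) (u i) - x (u i)\<bar> < s"
    by (auto simp: eventually_sequentially)
  define n where "n = max n0 t"
  define L where "L = Suc k + r n"
  have "t \<le> r n" using strict_mono_imp_increasing[OF r, of n] by (simp add: n_def)
  then have L: "k < L" "t < L" by (auto simp: L_def)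
  have XL: "close (1/2) (m (Suc t)) (X L) x"
    using n0[of n] by (auto simp: close_def L_def n_def s_def intro: less_imp_le)
  moreover have "close (1/2) (m t) (X L) x"
    using strict_mono_less_eq[OF m, of t "Suc t"] by (intro close_mono_index[OF XL]) auto
  ultimately have "close (1/2 + 1/2) (m (Suc t)) (X L) (y (Suc t))" "close (1/2 + 1/2) (m t) (X L) (y t)"
    by (blast intro: close_triangle y(2))+
  then show False using bad[OF L(1) t(1) L(2) y(1) y(1)] small by simp
qed

section \<open>Summable changes of the guesses, and the norming blocks\<close>

lemma telescoping_step:
  assumes z: "norm z \<le> 1" and y: "norm y \<le> 1" and y': "norm (y' - y) \<le> e" "e \<le> 1"
    and near: "N y + c * norm (z - (y' - y) - y) - e \<le> N (z - (y' - y))"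
  shows "c * norm (z - y) \<le> N z - N y + (c + 6) * e"
proof -
  \<comment> \<open>Growth near \<open>y\<close> requires agreement at the finer stage, which
    \<open>y'\<close> offers but \<open>y\<close> may not; by \<open>close_shift\<close>, moving
    \<open>z\<close> by the small difference turns closeness to \<open>y'\<close> into closeness to
    \<open>y\<close>. The costs are 5 * e (Lipschitz), e (growth) and c * e (triangle
    inequality).\<close>
  define v where "v = z - (y' - y)"
  have "N v \<le> N z + 5 * norm (v - z)"
    using z y' norm_minus_commute[of y y'] by (intro near_lipschitz) (simp_all add: v_def)
  also have "norm (v - z) \<le> e" using y' norm_minus_commute[of y y'] by (simp add: v_def)
  finally have Nv: "N v \<le> N z + 5 * e" by simp
  have "z - y = v - y + (y' - y)" by (simp add: v_def)
  then have "norm (z - y) \<le> norm (v - y) + e"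
    using norm_triangle_ineq[of "v - y" "y' - y"] y' by (simp only:)
  then have "c * norm (z - y) \<le> c * norm (v - y) + c * e"
    using mult_left_mono[of _ _ c] c_pos by (simp add: distrib_left[symmetric])
  then show ?thesis using Nv near by (simp add: v_def algebra_simps)
qed

lemma sum_halves: "(\<Sum>j<J. (1/2) ^ j) \<le> (2::real)"
  by (simp add: sum_gp_strict)

lemma close_shift: "close r m z y' \<Longrightarrow> close r m (z - (y' - y)) y"
  by (simp add: close_def blinfun.diff_left)

lemma norming_null_blocks:
  obtains G :: "nat \<Rightarrow> ('a \<Rightarrow>\<^sub>L real) set" and d where "\<And>j. finite (G j)" "\<And>j f. f \<in> G j \<Longrightarrow> norm f \<le> 1"
    and "\<And>i e. 0 < e \<Longrightarrow> \<exists>J. \<forall>j\<ge>J. \<forall>f\<in>G j. \<bar>blinfun_apply f (u i)\<bar> < e"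
    and "0 < d" "\<And>v. v \<noteq> 0 \<Longrightarrow> \<exists>j. \<exists>f\<in>G j. d * norm v \<le> \<bar>blinfun_apply f v\<bar>"
proof -
  obtain m E where m: "strict_mono m" "\<And>t. 4 ^ t \<le> real (m t) + 1"
    and E: "\<And>t. finite (E t)" "\<And>t. E t \<subseteq> cball 0 1"
    and net: "\<And>t x. x \<in> cball 0 1 \<Longrightarrow>
      \<exists>y\<in>E t. close (1/2) (m t) x y \<and> N y \<le> N x + 1 / (real (m t) + 1)"
    and near: "\<And>t y z. y \<in> E t \<Longrightarrow> norm z \<le> 2 \<Longrightarrow> close 2 (m (Suc t)) z y \<Longrightarrow>
      N y + c * norm (z - y) - (1/2) ^ t \<le> N z"
    by (rule guesses, rule that)
  have mt: "t \<le> m t" for t using m(1) by (rule strict_mono_imp_increasing)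
  have m_le: "m s \<le> m t" if "s \<le> t" for s t
    using that m(1) by (simp add: strict_mono_less_eq)
  have "\<exists>L>k. \<forall>x\<in>cball 0 1. \<exists>t y y'. k \<le> t \<and> t < L \<and> y \<in> E t \<and> y' \<in> E (Suc t) \<and>
      close 1 (m t) x y \<and> close 1 (m (Suc t)) x y' \<and> norm (y' - y) \<le> (1/2) ^ j" for k j
    by (rule small_change[OF m(1) E(2) net]) auto
  then obtain L where L: "\<And>k j. k < L k j" "\<And>k j x. x \<in> cball 0 1 \<Longrightarrow>
      \<exists>t y y'. k \<le> t \<and> t < L k j \<and> y \<in> E t \<and> y' \<in> E (Suc t) \<and>
      close 1 (m t) x y \<and> close 1 (m (Suc t)) x y' \<and> norm (y' - y) \<le> (1/2) ^ j"
    by metis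
  \<comment> \<open>The stages from \<kappa> j to below \<kappa> (Suc j) form block j, long enough
    for every functional of the unit ball to have in it two consecutive guesses within (1/2) ^
    j.\<close>
  define \<kappa> where "\<kappa> = rec_nat 0 (\<lambda>j k. L k j)"
  have \<kappa>_Suc: "\<kappa> (Suc j) = L (\<kappa> j) j" for j by (simp add: \<kappa>_def)
  have "strict_mono \<kappa>" by (rule strict_monoI_Suc) (simp add: \<kappa>_Suc L(1))
  then have \<kappa>: "j \<le> \<kappa> j" for j by (rule strict_mono_imp_increasing)
  define U where "U j = (\<Union>t\<in>{\<kappa> j..<\<kappa> (Suc j)}. E t)" for j
  \<comment> \<open>Guesses of one functional in neighbouring blocks always form such a pair, both
    being \<open>close 1\<close> to it.\<close>
  define P where "P j = {(y, w) \<in> U j \<times> U (Suc j). close 2 (m (\<kappa> j)) w y}" for j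
  \<comment> \<open>The lower bound \<open>(1/2) ^ j\<close> on the denominator keeps short differences weak\<open>*\<close>-null after
    normalisation, and it is summable.\<close>
  define q :: "nat \<Rightarrow> ('a \<Rightarrow>\<^sub>L real) \<times> ('a \<Rightarrow>\<^sub>L real) \<Rightarrow> ('a \<Rightarrow>\<^sub>L real)"
    where "q j = (\<lambda>(y, w). (1 / max (norm (w - y)) ((1/2) ^ j)) *\<^sub>R (w - y))" for j
  \<comment> \<open>The guesses of block 0 are included because the differences control
    \<open>y J v\<close> only up to the initial value \<open>y 0 v\<close>.\<close>
  define G where "G = case_nat (U 0) (\<lambda>j. q j ` P j)"
  have G: "G 0 = U 0" "G (Suc j) = q j ` P j" for j by (simp_all add: G_def)
  have U: "finite (U j)" "U j \<subseteq> cball 0 1" for j using E by (auto simp: U_def)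
  have "P j \<subseteq> U j \<times> U (Suc j)" for j by (auto simp: P_def)
  then have "finite (P j)" for j by (rule finite_subset) (simp add: U)
  then have fin: "finite (G j)" for j by (cases j) (simp_all add: G U)
  have nq: "norm (q j p) \<le> 1" for j p
  proof -
    obtain y w where p: "p = (y, w)" by force
    have "0 < max (norm (w - y)) ((1/2) ^ j)" by (simp add: less_max_iff_disj)
    then show ?thesis by (simp add: p q_def divide_le_eq)
  qed
  then have bd: "norm f \<le> 1" if "f \<in> G j" for j f
    using that U(2)[of 0] by (cases j) (auto simp: G)
  have null: "\<exists>J. \<forall>j\<ge>J. \<forall>f\<in>G j. \<bar>blinfun_apply f (u i)\<bar> < e" if e: "0 < e" for i e
  proof -
    obtain n where n: "(1/2) ^ n < e / 2" using real_arch_pow_inv[of "e / 2" "1/2"] e by auto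
    have "\<bar>blinfun_apply f (u i)\<bar> < e" if j: "j \<ge> max n (Suc i)" and f: "f \<in> G (Suc j)" for j f
    proof -
      obtain y w where yw: "close 2 (m (\<kappa> j)) w y" "f = q j (y, w)"
        using f by (auto simp: G P_def)
      define b where "b = max (norm (w - y)) ((1/2) ^ j)"
      have b: "(1/2) ^ j \<le> b" "0 < b" by (simp_all add: b_def less_max_iff_disj)
      have "i < m (\<kappa> j)" using j \<kappa>[of j] mt[of "\<kappa> j"] by linarith
      then have "\<bar>w (u i) - y (u i)\<bar> \<le> 2 / (real (m (\<kappa> j)) + 1)"
        using yw(1) by (simp add: close_def)
      also have "\<dots> \<le> 2 / 4 ^ j"
      proof (rule divide_left_mono)
        have "(4::real) ^ j \<le> 4 ^ \<kappa> j" using \<kappa>[of j] by (intro power_increasing) auto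
        also have "\<dots> \<le> real (m (\<kappa> j)) + 1" by (rule m(2))
        finally show "4 ^ j \<le> real (m (\<kappa> j)) + 1" .
      qed auto
      \<comment> \<open>One factor (1/2) ^ j is absorbed by the denominator \<open>b\<close>, the
        other makes the values tend to 0.\<close>
      also have "(2::real) / 4 ^ j = 2 * (1/2) ^ j * (1/2) ^ j"
        by (simp add: power_divide power_mult_distrib[symmetric])
      finally have "\<bar>f (u i)\<bar> \<le> 2 * (1/2) ^ j * (1/2) ^ j / b"
        using b(2) by (simp add: yw(2) q_def b_def[symmetric] blinfun.scaleR_left blinfun.diff_left
          abs_mult divide_right_mono)
      also have "\<dots> \<le> 2 * (1/2) ^ j * b / b"
        using b by (intro divide_right_mono mult_left_mono) auto
      also have "\<dots> = 2 * (1/2) ^ j" using b by simp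
      also have "\<dots> \<le> 2 * (1/2) ^ n" using j by (intro mult_left_mono power_decreasing) auto
      also have "\<dots> < e" using n by simp
      finally show ?thesis .
    qed
    then show ?thesis
      by (intro exI[of _ "Suc (max n (Suc i))"]) (metis Suc_le_D Suc_le_mono)
  qed
  \<comment> \<open>\<open>C\<close> is 1 for the initial guess, plus 16 / c + 2 for the total
    variation, plus 2 for the sum of the (1/2) ^ j from the denominators. Then \<open>d\<close>
    makes the total half of \<open>norm v\<close>.\<close>
  define C where "C = 5 + 16 / c"
  have C: "C > 0" using c_pos by (simp add: C_def add_pos_pos)
  define d where "d = 1 / (2 * C)"
  have d: "d > 0" using C by (simp add: d_def)
  have norming: "\<exists>j. \<exists>f\<in>G j. d * norm v \<le> \<bar>blinfun_apply f v\<bar>" if v: "v \<noteq> 0" for v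
  proof (rule ccontr)
    assume "\<not> ?thesis"
    then have less: "\<bar>blinfun_apply f v\<bar> \<le> d * norm v" if "f \<in> G j" for f j
      using that by (meson le_cases)
    \<comment> \<open>The guesses of this functional converge weak* to it; small values on all
      blocks would keep them at most \<open>norm v / 2\<close> at \<open>v\<close>, although
      \<open>x\<close> takes the value \<open>norm v\<close> there.\<close>
    obtain x :: "'a \<Rightarrow>\<^sub>L real" where x: "norm x \<le> 1" "blinfun_apply x v = norm v"
      using ex_norming_functional by blast
    have "x \<in> cball 0 1" using x by simp
    then have "\<forall>j. \<exists>t y y'. \<kappa> j \<le> t \<and> t < \<kappa> (Suc j) \<and> y \<in> E t \<and> y' \<in> E (Suc t) \<and>
      close 1 (m t) x y \<and> close 1 (m (Suc t)) x y' \<and> norm (y' - y) \<le> (1/2) ^ j"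
      unfolding \<kappa>_Suc using L(2) by blast
    then obtain t y y' where t: "\<And>j. \<kappa> j \<le> t j" "\<And>j. t j < \<kappa> (Suc j)"
      and y: "\<And>j. y j \<in> E (t j)" "\<And>j. y' j \<in> E (Suc (t j))"
        "\<And>j. close 1 (m (t j)) x (y j)" "\<And>j. close 1 (m (Suc (t j))) x (y' j)"
        "\<And>j. norm (y' j - y j) \<le> (1/2) ^ j"
      by metis
    have ny: "norm (y j) \<le> 1" for j using y(1)[of j] E(2)[of "t j"] by auto
    have tj: "j \<le> t j" for j using t(1)[of j] \<kappa>[of j] by simp
    have yU: "y j \<in> U j" for j
      unfolding U_def by (rule UN_I[of "t j"]) (simp_all add: t y(1))
    have t_Suc: "Suc (t j) \<le> t (Suc j)" for j using t(1)[of "Suc j"] t(2)[of j] by simp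
    have step: "c * norm (y (Suc j) - y j) \<le> N (y (Suc j)) - N (y j) + (c + 6) * (1/2) ^ j" for j
    proof (rule telescoping_step[OF ny ny y(5)])
      let ?z = "y (Suc j) - (y' j - y j)"
      show "(1/2) ^ j \<le> (1::real)" by (simp add: power_le_one)
      have "norm ?z \<le> 2"
        using norm_triangle_ineq4[of "y (Suc j)" "y' j - y j"] ny[of "Suc j"] y(5)[of j]
          power_le_one[of "1/2::real" j] by simp
      \<comment> \<open>The next guess is made at stage \<open>Suc (t j)\<close> or later, so it is
        close to \<open>x\<close> at the stage of \<open>y' j\<close>; the two tolerances add up to
        the 2 in \<open>near\<close>.\<close>
      moreover have "close 1 (m (Suc (t j))) (y (Suc j)) x"
        using close_mono_index[OF close_sym[OF y(3)[of "Suc j"]]] m_le[OF t_Suc] by simp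
      from close_triangle[OF this y(4)] have "close 2 (m (Suc (t j))) ?z (y j)"
        by (intro close_shift) simp
      ultimately have "N (y j) + c * norm (?z - y j) - (1/2) ^ t j \<le> N ?z"
        using near[OF y(1)] by blast
      moreover have "(1/2) ^ t j \<le> (1/2::real) ^ j" using tj by (intro power_decreasing) auto
      ultimately show "N (y j) + c * norm (?z - y j) - (1/2) ^ j \<le> N ?z" by linarith
    qed
    \<comment> \<open>\<open>N\<close> increases by at most 1 + 3 in total and the errors sum to at
      most 2 * (c + 6); division by \<open>c\<close> gives the bound.\<close>
    have var: "(\<Sum>j<J. norm (y (Suc j) - y j)) \<le> 16 / c + 2" for J
    proof -
      have "c * (\<Sum>j<J. norm (y (Suc j) - y j))
          \<le> (\<Sum>j<J. N (y (Suc j)) - N (y j) + (c + 6) * (1/2) ^ j)"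
        unfolding sum_distrib_left by (intro sum_mono step)
      also have "\<dots> = N (y J) - N (y 0) + (c + 6) * (\<Sum>j<J. (1/2) ^ j)"
        by (simp only: sum.distrib sum_lessThan_telescope[of "\<lambda>j. N (y j)"] sum_distrib_left)
      also have "\<dots> \<le> 1 + 3 + (c + 6) * 2"
        using upper[of "y J"] lower[of "y 0"] ny[of J] ny[of 0] sum_halves[of J] c_pos
        by (intro add_mono mult_left_mono) auto
      finally show ?thesis using c_pos by (simp add: field_simps)
    qed
    have inc: "\<bar>y (Suc j) v - y j v\<bar> \<le> (norm (y (Suc j) - y j) + (1/2) ^ j) * (d * norm v)" for j
    proof -
      define b where "b = max (norm (y (Suc j) - y j)) ((1/2) ^ j)"
      have b: "0 < b" "b \<le> norm (y (Suc j) - y j) + (1/2) ^ j"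
        by (auto simp: b_def less_max_iff_disj)
      have "y j \<in> U j" "y (Suc j) \<in> U (Suc j)" by (rule yU)+
      moreover have "close 1 (m (\<kappa> j)) (y (Suc j)) x"
        using close_mono_index[OF close_sym[OF y(3)[of "Suc j"]]] m_le[of "\<kappa> j" "t (Suc j)"]
          t(1)[of j] t_Suc[of j] by simp
      moreover have "close 1 (m (\<kappa> j)) x (y j)"
        using close_mono_index[OF y(3)] m_le[OF t(1)] by simp
      ultimately have "(y j, y (Suc j)) \<in> P j"
        unfolding P_def using close_triangle by fastforce
      then have "q j (y j, y (Suc j)) \<in> G (Suc j)" by (simp add: G)
      from less[OF this] have "\<bar>y (Suc j) v - y j v\<bar> / b \<le> d * norm v"
        using b(1) by (simp add: q_def b_def[symmetric] blinfun.scaleR_left blinfun.diff_left abs_mult)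
      then have "\<bar>y (Suc j) v - y j v\<bar> \<le> b * (d * norm v)"
        using b(1) by (simp add: pos_divide_le_eq mult.commute)
      also have "\<dots> \<le> (norm (y (Suc j) - y j) + (1/2) ^ j) * (d * norm v)"
        using b(2) d by (intro mult_right_mono) auto
      finally show ?thesis .
    qed
    have "y J v \<le> norm v / 2" for J
    proof -
      have "y 0 \<in> G 0" unfolding G by (rule yU)
      then have "y 0 v \<le> d * norm v" using less[of "y 0" 0] by simp
      moreover have "y J v - y 0 v = (\<Sum>j<J. y (Suc j) v - y j v)"
        by (simp only: sum_lessThan_telescope[of "\<lambda>j. blinfun_apply (y j) v"])
      moreover have "\<dots> \<le> (\<Sum>j<J. (norm (y (Suc j) - y j) + (1/2) ^ j) * (d * norm v))"
        by (intro sum_mono order_trans[OF abs_ge_self inc])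
      moreover have "\<dots> = ((\<Sum>j<J. norm (y (Suc j) - y j)) + (\<Sum>j<J. (1/2) ^ j)) * (d * norm v)"
        by (simp only: sum_distrib_right[symmetric] sum.distrib)
      moreover have "\<dots> \<le> ((16 / c + 2) + 2) * (d * norm v)"
        using var[of J] sum_halves[of J] d by (intro mult_right_mono add_mono) auto
      ultimately have "y J v \<le> d * norm v + ((16 / c + 2) + 2) * (d * norm v)" by linarith
      also have "\<dots> = C * (d * norm v)" by (simp add: C_def algebra_simps)
      also have "\<dots> = norm v / 2" using C by (simp add: d_def)
      finally show ?thesis .
    qed
    moreover have "(\<lambda>j. blinfun_apply (y j) v) \<longlonglongrightarrow> blinfun_apply x v"
      using ny close_sym[OF y(3)] order_trans[OF tj mt] by (rule close_tendsto)
    ultimately have "x v \<le> norm v / 2" by (intro LIMSEQ_le_const2) auto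
    then show False using v x(2) by simp
  qed
  show ?thesis
    by (rule that[of G d]) (fact fin bd null d norming)+
qed

end

theorem theorem3p3:
  assumes "separable_space (euclidean :: 'a::banach topology)"
    and "weak_star_summable_tree_property TYPE('a)"
  shows "isomorphic_to_subspace_of TYPE('a) c0"
proof -
  obtain c where c: "c > 0" "weak_star_summable_tree_property_with TYPE('a) c"
    using assms(2) by (auto simp: weak_star_summable_tree_property_def)
  obtain D :: "'a set" where D: "countable D" "closure D = UNIV"
    using assms(1) by (auto simp: separable_space_def)
  then have u: "range (from_nat_into D) = D" by (intro range_from_nat_into) auto
  interpret weak_star_growth "tree_value c :: ('a \<Rightarrow>\<^sub>L real) \<Rightarrow> real" c "from_nat_into D"
    using c D u by (intro weak_star_growth_tree_value) simp_all
  obtain G :: "nat \<Rightarrow> ('a \<Rightarrow>\<^sub>L real) set" and d where G: "\<And>j. finite (G j)" "\<And>j f. f \<in> G j \<Longrightarrow> norm f \<le> 1"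
    "\<And>i e. 0 < e \<Longrightarrow> \<exists>J. \<forall>j\<ge>J. \<forall>f\<in>G j. \<bar>blinfun_apply f (from_nat_into D i)\<bar> < e"
    "0 < d" "\<And>v. v \<noteq> 0 \<Longrightarrow> \<exists>j. \<exists>f\<in>G j. d * norm v \<le> \<bar>blinfun_apply f v\<bar>"
    by (rule norming_null_blocks, rule that)
  show ?thesis
  proof (rule isomorphic_to_subspace_of_c0_blocks[OF G(1,2) D(2) _ G(4,5)])
    fix v :: 'a and e :: real
    assume "v \<in> D" "0 < e"
    then obtain i where "v = from_nat_into D i" using u by blast
    then show "\<exists>J. \<forall>j\<ge>J. \<forall>f\<in>G j. \<bar>blinfun_apply f v\<bar> < e" using G(3)[OF \<open>0 < e\<close>] by simp
  qed
qed

end
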